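(* Let $d\ge 2$, let $\alpha,\omega,B,\Omega,L$ be as fixed in the context, and put $\beta=B\alpha\in\mathbb{R}^d$. Assume that $\Omega\in\mathbb{R}^{d-1}$ satisfies $$\lim_{N\to\infty}\frac1N\ \sup_{k\in\mathbb{Z}^{d-1},\,0<|k|\le N}\big|\ln \mathrm{dist}(k\cdot\Omega,\mathbb{Z})\big|=0 ,$$ and that $W:D_\rho\to\mathbb{C}$ is an analytic function for some $\rho>0$. Then there exist formal power series in $\epsilon$, $$v(\psi,\eta)=\sum_{n=0}^\infty \epsilon^n v^n(\psi,\eta),\qquad \lambda(\eta)=\sum_{n=0}^\infty\epsilon^n\lambda^n(\eta),$$ which solve, in the sense of formal power series in $\epsilon$, the equation $$v(\psi+\Omega,\eta)+v(\psi-\Omega,\eta)-2v(\psi,\eta)+\epsilon\, W\big((\psi,\eta)+\beta v(\psi,\eta)\big)+\lambda(\eta)=0 .$$ For any $0<\delta<\rho$, each of the terms $v^n(\psi,\eta)$ is analytic in $D_{\rho-\delta}$. If $W$ takes real values for real arguments, then so do all the $v^n$, and $\lambda$ is real (i.e. each $\lambda^n(\eta)$ is real for real $\eta$).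
   Context: Notation: $\mathbb{T}^j=\mathbb{R}^j/\mathbb{Z}^j$. $D_\rho=\{\theta\in\mathbb{C}^d/\mathbb{Z}^d : |\mathrm{Im}(\theta_i)|<\rho \text{ for all } i\}$. Points of $D_\rho$ are written $(\psi,\eta)$, where $\psi$ denotes the first $d-1$ coordinates and $\eta$ the last one. $\mathrm{dist}(x,\mathbb{Z})$ is the distance from $x\in\mathbb{R}$ to the nearest integer, $|\ln 0|=+\infty$, and $|k|=\sum_i|k_i|$. Setting: $\alpha\in\mathbb{R}^d$ satisfies $k\cdot\alpha\ne0$ for all $k\in\mathbb{Z}^d\setminus\{0\}$. The number $\omega\in\mathbb{R}$ is resonant, i.e. there are $k\in\mathbb{Z}^d\setminus\{0\}$ and $m\in\mathbb{Z}$ with $k\cdot\omega\alpha=m$. The matrix $B\in SL(d,\mathbb{Z})$, the vector $\Omega\in\mathbb{R}^{d-1}$ (the intrinsic frequencies) and $L\in\mathbb{Z}^d$ are such that $B\omega\alpha=(\Omega,0)+L$ and $\Omega\cdot k\notin\mathbb{Z}$ for all $k\in\mathbb{Z}^{d-1}\setminus\{0\}$. Formal power series: the superscript $n$ in $v^n,\lambda^n$ is an index, not a power. The expression $W((\psi,\eta)+\beta\sum_n\epsilon^n v^n(\psi,\eta))$ is understood as the formal power series in $\epsilon$ obtained by Taylor expanding $W$ at $(\psi,\eta)+\beta v^0(\psi,\eta)$ (a point required to lie in $D_\rho$). The equation holds in the sense of formal power series if the coefficients of every power of $\epsilon$ on the left-hand side vanish identically. *)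

theory Defs
  imports "HOL-Complex_Analysis.Complex_Analysis"
begin

text \<open>
  For \<open>'n\<close> with \<open>d - 1\<close> elements, the type \<open>'n option\<close> has \<open>d \<ge> 2\<close> elements; the index
  \<open>None\<close> stands for the last of the \<open>d\<close> coordinates.
\<close>

definition join :: "'a^'n \<Rightarrow> 'a \<Rightarrow> 'a^('n option)" where
  "join \<psi> \<eta> = (\<chi> i. case i of Some j \<Rightarrow> \<psi> $ j | None \<Rightarrow> \<eta>)"

definition rvec :: "int^'m \<Rightarrow> real^'m" where
  "rvec k = (\<chi> i. real_of_int (k $ i))"

definition cvec :: "real^'m \<Rightarrow> complex^'m" where
  "cvec x = (\<chi> i. complex_of_real (x $ i))"

definition l1 :: "int^'m \<Rightarrow> int" where
  "l1 k = (\<Sum>i\<in>UNIV. \<bar>k $ i\<bar>)"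

text \<open>\<open>|ln x|\<close> with the convention \<open>|ln 0| = \<infinity>\<close> (in HOL, \<open>ln 0 = 0\<close>).\<close>

definition abs_ln :: "real \<Rightarrow> ereal" where
  "abs_ln x = (if x = 0 then \<infinity> else ereal \<bar>ln x\<bar>)"

definition subexponential_divisors :: "real^'n \<Rightarrow> bool" where
  "subexponential_divisors \<Omega> \<longleftrightarrow>
     (\<lambda>N. ereal (1 / real N) *
        (SUP k \<in> {k :: int^'n. 0 < l1 k \<and> l1 k \<le> int N}. abs_ln (infdist (rvec k \<bullet> \<Omega>) \<int>)))
     \<longlonglongrightarrow> 0"

text \<open>
  A function on a subset of the complex torus is represented by its periodic lift, so
  \<open>strip \<rho>\<close> is the preimage of \<open>D\<^sub>\<rho>\<close> in complex \<open>d\<close>-space. Values of the lift outside the strip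
  are irrelevant.
\<close>

definition strip :: "real \<Rightarrow> (complex^'m) set" where
  "strip \<rho> = {\<theta>. \<forall>i. \<bar>Im (\<theta> $ i)\<bar> < \<rho>}"

definition periodic_on :: "(complex^'m) set \<Rightarrow> (complex^'m \<Rightarrow> 'b) \<Rightarrow> bool" where
  "periodic_on S f \<longleftrightarrow> (\<forall>\<theta>\<in>S. \<forall>k. f (\<theta> + cvec (rvec k)) = f \<theta>)"

text \<open>
  Counterpart for several variables of the library's \<open>analytic_on\<close>: complex differentiability
  (a complex-linear Frechet derivative) in a neighbourhood of each point.
\<close>

definition mv_analytic_on :: "(complex^'m \<Rightarrow> complex) \<Rightarrow> (complex^'m) set \<Rightarrow> bool" where
  "mv_analytic_on f S \<longleftrightarrow>
     (\<forall>z\<in>S. \<exists>e>0. \<forall>w\<in>ball z e.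
        \<exists>D. (f has_derivative D) (at w) \<and> (\<forall>c x. D (c *s x) = c * D x))"

text \<open>
  The formal power series \<open>W (\<theta> + b a)\<close> for a vector \<open>b\<close> and a formal power series
  \<open>a = a\<^sub>0 + a\<^sub>1 X + \<dots>\<close>: the Taylor series of \<open>W\<close> at \<open>\<theta> + a\<^sub>0 b\<close> in the increment \<open>s b\<close>,
  that is, the sum over \<open>m\<close> of \<open>D\<^sup>mW(\<theta> + a\<^sub>0 b)[b,\<dots>,b] s\<^sup>m / m!\<close>, into which \<open>s = a - a\<^sub>0\<close>
  (without constant term) is substituted.
\<close>

definition fps_taylor ::
    "(complex^'m \<Rightarrow> complex) \<Rightarrow> complex^'m \<Rightarrow> complex^'m \<Rightarrow> complex fps \<Rightarrow> complex fps" where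
  "fps_taylor W \<theta> b a =
     (let z = \<theta> + fps_nth a 0 *s b in
      fps_compose (fps_expansion (\<lambda>s. W (z + s *s b)) 0) (a - fps_const (fps_nth a 0)))"

end

theory Submission
  imports Defs
begin

text \<open>
  Take \<open>v\<^sup>0 = 0\<close>. At order \<open>n > 0\<close> the equation says that the second difference of \<open>v\<^sup>n\<close> along
  \<open>\<Omega>\<close> equals \<open>- R - \<lambda>\<^sup>n\<close>, where \<open>R\<close> depends only on the terms of lower order. With \<open>\<lambda>\<^sup>n\<close> minus the
  average of \<open>R\<close> over \<open>\<psi>\<close>, this is solved by dividing the Fourier coefficients of \<open>R\<close> by
  \<open>2 - 2 cos (2 \<pi> k \<cdot> \<Omega>)\<close>. By the hypothesis on \<open>\<Omega>\<close> the reciprocals of these divisors grow more slowly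
  than every exponential, so no analyticity is lost. All Fourier series are taken over all \<open>d\<close>
  coordinates at once; then \<open>\<lambda>\<^sup>n\<close> collects the frequencies that vanish in the \<open>\<psi>\<close> directions.

  Fourier inversion on the torus is iterated from the case of one variable. There the mean of a
  periodic holomorphic \<open>f\<close> is the increment of a primitive over a period, and
  \<open>f z - f z\<^sub>0 = (exp (2 \<pi> \<i> (z - z\<^sub>0)) - 1) g z\<close> with \<open>g\<close> periodic and holomorphic, so that the
  terms of the Fourier series of \<open>f\<close> at \<open>z\<^sub>0\<close> telescope.
\<close>

section \<open>Fourier series of periodic holomorphic functions of one variable\<close>

text \<open>The proof rests on a correspondence: a periodic function analytic on
  \<open>strip \<rho>\<close> has Fourier coefficients that decay at every exponential rate 2 pi r
  with r < \<rho>, and conversely such a series is analytic on the whole strip. Since no single rate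
  is distinguished, a factor growing more slowly than every exponential is absorbed by passing to a
  slightly larger r. Hence every order of the recursion lives on the same strip, and derivatives
  along \<beta>, whose coefficients gain only a factor linear in the frequency, are handled in the
  same way as the small divisors. The obstacle is to pass from one variable to several: the
  coefficient in one variable must again be holomorphic in the others, with bounds that multiply up
  to exp (- 2 pi r |k|). The first point is settled by uniformly convergent Riemann sums, the second
  by stating each bound on coefficients with the same constant M that bounds the function.\<close>

definition band :: "real \<Rightarrow> complex set" where
  "band \<rho> = {z. \<bar>Im z\<bar> < \<rho>}"

lemma band_eq_vimage: "band \<rho> = Im -` {-\<rho><..<\<rho>}"
  by (auto simp: band_def)

lemma open_band: "open (band \<rho>)"
  unfolding band_eq_vimage by (intro open_vimage continuous_intros open_greaterThanLessThan)

lemma convex_band: "convex (band \<rho>)"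
  unfolding band_eq_vimage
  by (intro convex_linear_vimage) (auto intro: bounded_linear.linear bounded_linear_Im)

lemma cball_subset_band: "\<bar>Im z\<bar> + e < \<rho> \<Longrightarrow> cball z e \<subseteq> band \<rho>"
proof
  fix w assume "\<bar>Im z\<bar> + e < \<rho>" "w \<in> cball z e"
  then show "w \<in> band \<rho>"
    using abs_Im_le_cmod[of "z - w"] by (auto simp: band_def dist_norm)
qed

definition cexp :: "complex \<Rightarrow> complex" where
  "cexp z = exp (2 * of_real pi * \<i> * z)"

lemma cexp_add: "cexp (z + w) = cexp z * cexp w"
  by (simp add: cexp_def exp_add ring_distribs)

lemma cexp_0 [simp]: "cexp 0 = 1"
  by (simp add: cexp_def)

lemma cexp_eq_1_iff: "cexp z = 1 \<longleftrightarrow> z \<in> \<int>"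
proof -
  have "cexp z = 1 \<longleftrightarrow> Im z = 0 \<and> (\<exists>n::int. Re z = of_int n)"
    unfolding cexp_def exp_eq_1 by simp
  also have "\<dots> \<longleftrightarrow> (\<exists>n::int. z = of_int n)"
    by (auto simp: complex_eq_iff)
  finally show ?thesis
    by (auto simp: Ints_def)
qed

lemma cexp_of_int [simp]: "cexp (of_int n) = 1"
  by (simp add: cexp_eq_1_iff)

lemma norm_cexp: "norm (cexp z) = exp (- 2 * pi * Im z)"
  by (simp add: cexp_def)

lemma cnj_cexp: "cnj (cexp z) = cexp (- cnj z)"
  by (simp add: cexp_def exp_cnj)

lemma holomorphic_on_cexp [holomorphic_intros]: "f holomorphic_on S \<Longrightarrow> (\<lambda>z. cexp (f z)) holomorphic_on S"
  unfolding cexp_def by (intro holomorphic_intros)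

lemma DERIV_cexp: "(cexp has_field_derivative 2 * of_real pi * \<i> * cexp z) (at z)"
  unfolding cexp_def[abs_def] by (auto intro!: derivative_eq_intros)

section \<open>Periodic holomorphic functions on a band, their means and Fourier
  coefficients\<close>

definition periodic_holo :: "real \<Rightarrow> (complex \<Rightarrow> complex) \<Rightarrow> bool" where
  "periodic_holo \<rho> f \<longleftrightarrow> f holomorphic_on band \<rho> \<and> (\<forall>z\<in>band \<rho>. f (z + 1) = f z)"

lemma band_add_real [simp]: "z + of_int m \<in> band \<rho> \<longleftrightarrow> z \<in> band \<rho>" "z + 1 \<in> band \<rho> \<longleftrightarrow> z \<in> band \<rho>"
   "z + of_real x \<in> band \<rho> \<longleftrightarrow> z \<in> band \<rho>"
  by (auto simp: band_def)

lemma periodic_holo_add_of_nat: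
  assumes "periodic_holo \<rho> f" "z \<in> band \<rho>"
  shows "f (z + of_nat m) = f z"
proof (induction m)
  case (Suc m)
  have "z + of_nat m \<in> band \<rho>"
    using assms(2) by (simp add: band_def)
  then show ?case
    using assms Suc unfolding periodic_holo_def by (metis add.assoc add.commute of_nat_Suc)
qed simp

lemma periodic_holo_add_of_int:
  assumes "periodic_holo \<rho> f" "z \<in> band \<rho>"
  shows "f (z + of_int m) = f z"
proof (cases m)
  case (nonneg n)
  then show ?thesis using periodic_holo_add_of_nat[OF assms, of n] by simp
next
  case (neg n)
  have "z + of_int m \<in> band \<rho>" using assms by simp
  from periodic_holo_add_of_nat[OF assms(1) this, of "Suc n"] show ?thesis
    using neg by simp
qed

text \<open>A contour integral rather than an integral over a real interval, so that primitives
  apply and the path can be moved off the real axis.\<close>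

definition mean :: "(complex \<Rightarrow> complex) \<Rightarrow> complex" where
  "mean f = contour_integral (linepath 0 1) f"

lemma contour_integrable_linepath_band:
  assumes "f holomorphic_on band \<rho>" "a \<in> band \<rho>" "b \<in> band \<rho>"
  shows "f contour_integrable_on linepath a b"
proof (rule contour_integrable_holomorphic_simple[OF assms(1) open_band])
  show "path_image (linepath a b) \<subseteq> band \<rho>"
    using assms convex_band by (simp add: convex_contains_segment)
qed simp

lemma linepath_primitive_band:
  assumes "\<And>z. z \<in> band \<rho> \<Longrightarrow> (P has_field_derivative f z) (at z within band \<rho>)"
    and "a \<in> band \<rho>" "b \<in> band \<rho>"
  shows "contour_integral (linepath a b) f = P b - P a"
proof (rule contour_integral_unique)
  have "path_image (linepath a b) \<subseteq> band \<rho>"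
    using assms convex_band by (simp add: convex_contains_segment)
  from contour_integral_primitive[OF assms(1) _ this]
  show "(f has_contour_integral P b - P a) (linepath a b)" by simp
qed

lemma periodic_holo_primitive:
  assumes "periodic_holo \<rho> f" "\<rho> > 0"
  obtains P where "\<And>z. z \<in> band \<rho> \<Longrightarrow> (P has_field_derivative f z) (at z)"
    "\<And>z. z \<in> band \<rho> \<Longrightarrow> P (z + 1) - P z = mean f"
proof -
  obtain P where P: "\<And>z. z \<in> band \<rho> \<Longrightarrow> (P has_field_derivative f z) (at z within band \<rho>)"
    using holomorphic_convex_primitive'[OF convex_band open_band] assms(1)
    unfolding periodic_holo_def by metis
  have P': "(P has_field_derivative f z) (at z)" if "z \<in> band \<rho>" for z
    using P[OF that] that by (simp add: at_within_open[OF _ open_band])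
  have "\<exists>c. \<forall>z\<in>band \<rho>. P (z + 1) - P z = c"
  proof (rule has_field_derivative_zero_constant[OF convex_band])
    fix z assume z: "z \<in> band \<rho>"
    have "((\<lambda>z. P (z + 1)) has_field_derivative f (z + 1)) (at z)"
      using P'[of "z + 1"] z by (subst DERIV_shift[symmetric]) simp
    then have "((\<lambda>z. P (z + 1) - P z) has_field_derivative f (z + 1) - f z) (at z)"
      by (intro derivative_intros P' z)
    then show "((\<lambda>z. P (z + 1) - P z) has_field_derivative 0) (at z within band \<rho>)"
      using assms(1) z by (simp add: periodic_holo_def has_field_derivative_at_within)
  qed
  then obtain c where c: "\<And>z. z \<in> band \<rho> \<Longrightarrow> P (z + 1) - P z = c" by blast
  have "mean f = P 1 - P 0"
    unfolding mean_def by (rule linepath_primitive_band[OF P]) (use assms in \<open>auto simp: band_def\<close>)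
  with c[of 0] have "mean f = c" using assms by (simp add: band_def)
  with P' c that show ?thesis by metis
qed

text \<open>The increment of a primitive over a period is the same at every height, so the path may
  be moved from the real axis to the line Im z = \<tau>. A bound on that one line suffices, which is
  the source of all exponential decay below.\<close>

lemma mean_bound:
  assumes f: "periodic_holo \<rho> f" and \<tau>: "\<bar>\<tau>\<bar> < \<rho>" and M: "\<And>z. Im z = \<tau> \<Longrightarrow> norm (f z) \<le> M"
  shows "norm (mean f) \<le> M"
proof -
  have "\<rho> > 0" using \<tau> by simp
  obtain P where P: "\<And>z. z \<in> band \<rho> \<Longrightarrow> (P has_field_derivative f z) (at z)"
    "\<And>z. z \<in> band \<rho> \<Longrightarrow> P (z + 1) - P z = mean f"
    using periodic_holo_primitive[OF f \<open>\<rho> > 0\<close>] by blast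
  define z where "z = Complex 0 \<tau>"
  have z: "z \<in> band \<rho>" using \<tau> by (simp add: band_def z_def)
  have "mean f = contour_integral (linepath z (z + 1)) f"
    using P z by (subst linepath_primitive_band[of \<rho> P]) (auto simp: has_field_derivative_at_within)
  also have "norm \<dots> \<le> M * norm (z + 1 - z)"
  proof (rule contour_integral_bound_linepath)
    show "f contour_integrable_on linepath z (z + 1)"
      using f z by (intro contour_integrable_linepath_band) (auto simp: periodic_holo_def)
    show "0 \<le> M" using order_trans[OF norm_ge_zero M[of z]] by (simp add: z_def)
    fix x assume "x \<in> closed_segment z (z + 1)"
    then show "norm (f x) \<le> M"
      by (intro M) (auto simp: closed_segment_def z_def algebra_simps)
  qed
  finally show ?thesis by simp
qed

lemma mean_diff:
  assumes "periodic_holo \<rho> f" "periodic_holo \<rho> g" "\<rho> > 0"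
  shows "mean (\<lambda>z. f z - g z) = mean f - mean g"
  unfolding mean_def using assms
  by (intro contour_integral_diff contour_integrable_linepath_band[where \<rho> = \<rho>])
     (simp_all add: periodic_holo_def, simp_all add: band_def)

lemma mean_cmult:
  assumes "periodic_holo \<rho> f" "\<rho> > 0"
  shows "mean (\<lambda>z. c * f z) = c * mean f"
  unfolding mean_def using assms
  by (intro contour_integral_lmul contour_integrable_linepath_band[where \<rho> = \<rho>])
     (simp_all add: periodic_holo_def, simp_all add: band_def)

lemma mean_cong:
  assumes "\<And>z. z \<in> band \<rho> \<Longrightarrow> f z = g z" "\<rho> > 0"
  shows "mean f = mean g"
proof -
  have "closed_segment 0 1 \<subseteq> band \<rho>"
    using assms(2) by (intro closed_segment_subset convex_band) (auto simp: band_def)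
  then show ?thesis
    unfolding mean_def using assms by (intro contour_integral_cong) (auto simp: subset_iff)
qed

lemma periodic_holo_mult:
  "periodic_holo \<rho> f \<Longrightarrow> periodic_holo \<rho> g \<Longrightarrow> periodic_holo \<rho> (\<lambda>z. f z * g z)"
  by (auto simp: periodic_holo_def intro: holomorphic_intros)

lemma periodic_holo_diff:
  "periodic_holo \<rho> f \<Longrightarrow> periodic_holo \<rho> g \<Longrightarrow> periodic_holo \<rho> (\<lambda>z. f z - g z)"
  by (auto simp: periodic_holo_def intro: holomorphic_intros)

lemma periodic_holo_const [simp]: "periodic_holo \<rho> (\<lambda>z. c)"
  by (auto simp: periodic_holo_def intro: holomorphic_intros)

lemma periodic_holo_cexp [simp]: "periodic_holo \<rho> (\<lambda>z. cexp (of_int k * z))"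
proof -
  have "cexp (of_int k * (z + 1)) = cexp (of_int k * z)" for z
    by (simp add: distrib_left cexp_add)
  then show ?thesis by (auto simp: periodic_holo_def intro: holomorphic_intros)
qed

lemma mean_cexp: "mean (\<lambda>z. cexp (of_int k * z)) = (if k = 0 then 1 else 0)"
proof (cases "k = 0")
  case True
  then show ?thesis by (simp add: mean_def)
next
  case False
  let ?P = "\<lambda>z. cexp (of_int k * z) / (2 * of_real pi * \<i> * of_int k)"
  have "(?P has_field_derivative cexp (of_int k * z)) (at z within band 1)" for z
  proof -
    have "((\<lambda>z. cexp (of_int k * z)) has_field_derivative 2 * of_real pi * \<i> * cexp (of_int k * z) * of_int k) (at z)"
      by (rule DERIV_chain'[where g = cexp, OF _ DERIV_cexp]) (auto intro!: derivative_eq_intros)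
    from DERIV_cdivide[OF this, of "2 * of_real pi * \<i> * of_int k"]
    show ?thesis using False by (simp add: has_field_derivative_at_within)
  qed
  then have "mean (\<lambda>z. cexp (of_int k * z)) = ?P 1 - ?P 0"
    unfolding mean_def by (rule linepath_primitive_band) (auto simp: band_def)
  then show ?thesis using False by simp
qed

definition fcoeff :: "(complex \<Rightarrow> complex) \<Rightarrow> int \<Rightarrow> complex" where
  "fcoeff f k = mean (\<lambda>z. f z * cexp (of_int (- k) * z))"

lemma fcoeff_bound:
  assumes f: "periodic_holo \<rho> f" and r: "0 \<le> r" "r < \<rho>"
    and M: "\<And>z. \<bar>Im z\<bar> \<le> r \<Longrightarrow> norm (f z) \<le> M"
  shows "norm (fcoeff f k) \<le> M * exp (- 2 * pi * r * of_int \<bar>k\<bar>)"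
proof -
  \<comment> \<open>The sign is chosen against \<open>k\<close>: on the line Im z = \<tau> the
    factor cexp (- k z) has modulus exp (2 pi k \<tau>) = exp (- 2 pi r |k|).\<close>
  define \<tau> where "\<tau> = - r * of_int (sgn k)"
  have \<tau>: "\<bar>\<tau>\<bar> \<le> r" using r by (auto simp: \<tau>_def abs_mult sgn_if)
  have "M \<ge> 0" using order_trans[OF norm_ge_zero M[of 0]] r by simp
  show ?thesis unfolding fcoeff_def
  proof (rule mean_bound)
    show "periodic_holo \<rho> (\<lambda>z. f z * cexp (of_int (- k) * z))"
      using f by (intro periodic_holo_mult periodic_holo_cexp)
    show "\<bar>\<tau>\<bar> < \<rho>" using \<tau> r by simp
    fix z assume z: "Im z = \<tau>"
    have "norm (cexp (of_int (- k) * z)) = exp (- 2 * pi * r * of_int \<bar>k\<bar>)"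
      by (simp add: norm_cexp z \<tau>_def sgn_if abs_if)
    then show "norm (f z * cexp (of_int (- k) * z)) \<le> M * exp (- 2 * pi * r * of_int \<bar>k\<bar>)"
      using M[of z] z \<tau> by (simp add: norm_mult)
  qed
qed

text \<open>The factor \<open>cexp (z - z0) - 1\<close> vanishes exactly on z0 + Z, to first order
  with derivative 2 pi i, and by periodicity \<open>f z - f z0\<close> vanishes there too. So all
  singularities of the quotient are removable.\<close>

lemma fourier_quotient:
  assumes f: "periodic_holo \<rho> f" and z0: "z0 \<in> band \<rho>"
  obtains g where "periodic_holo \<rho> g"
    "\<And>z. z \<in> band \<rho> \<Longrightarrow> f z - f z0 = (cexp (z - z0) - 1) * g z"
proof -
  define g where "g = (\<lambda>z. if cexp (z - z0) = 1 then deriv f z / (2 * of_real pi * \<i>)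
    else (f z - f z0) / (cexp (z - z0) - 1))"
  have hf: "f holomorphic_on band \<rho>" using f by (simp add: periodic_holo_def)
  have f_eq: "f z = f z0" if e1: "cexp (z - z0) = 1" for z
  proof -
    obtain m where "z - z0 = of_int m" using e1 unfolding cexp_eq_1_iff by (rule Ints_cases)
    then have "z = z0 + of_int m" by (simp add: algebra_simps)
    then show ?thesis using periodic_holo_add_of_int[OF f z0] by simp
  qed
  have "f z - f z0 = (cexp (z - z0) - 1) * g z" if "z \<in> band \<rho>" for z
    using f_eq[of z] by (auto simp: g_def)
  moreover have "g holomorphic_on band \<rho>"
    unfolding analytic_on_open[OF open_band, symmetric] analytic_on_def
  proof
    fix a assume a: "a \<in> band \<rho>"
    show "\<exists>e>0. g holomorphic_on ball a e"
    proof (cases "cexp (a - z0) = 1")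
      case False
      have "open {z. cexp (z - z0) \<noteq> 1}"
        unfolding cexp_def by (intro open_Collect_neq continuous_intros)
      then have "open (band \<rho> \<inter> {z. cexp (z - z0) \<noteq> 1})" by (intro open_Int open_band)
      then obtain e where e: "e > 0" "ball a e \<subseteq> band \<rho> \<inter> {z. cexp (z - z0) \<noteq> 1}"
        using openE[of "band \<rho> \<inter> {z. cexp (z - z0) \<noteq> 1}" a] a False by blast
      have "(\<lambda>z. (f z - f z0) / (cexp (z - z0) - 1)) holomorphic_on ball a e"
        using e by (intro holomorphic_intros holomorphic_on_subset[OF hf]) auto
      then have "g holomorphic_on ball a e"
        by (rule holomorphic_transform) (use e in \<open>auto simp: g_def\<close>)
      with e show ?thesis by blast
    next
      case True
      \<comment> \<open>Near a zero \<open>a\<close> of the denominator, numerator and denominator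
        are both divided by z - a. The two difference quotients are holomorphic across
        \<open>a\<close>, and the second does not vanish near it.\<close>
      define F1 where "F1 = (\<lambda>z. if z = a then deriv f a else (f z - f a) / (z - a))"
      define E1 where "E1 = (\<lambda>z. if z = a then deriv (\<lambda>z. cexp (z - z0)) a
          else (cexp (z - z0) - cexp (a - z0)) / (z - a))"
      have F1: "F1 holomorphic_on band \<rho>"
        unfolding F1_def by (rule pole_lemma_open[OF hf open_band])
      have E1: "E1 holomorphic_on UNIV"
        unfolding E1_def by (rule pole_lemma_open) (auto intro!: holomorphic_intros)
      have "((\<lambda>z. cexp (z - z0)) has_field_derivative 2 * of_real pi * \<i> * cexp (a - z0)) (at a)"
        unfolding cexp_def by (auto intro!: derivative_eq_intros)
      then have dE: "deriv (\<lambda>z. cexp (z - z0)) a = 2 * of_real pi * \<i>"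
        using True by (simp add: DERIV_imp_deriv)
      \<comment> \<open>Zeros differ by integers, so the unit disc about \<open>a\<close> contains
        no other one.\<close>
      have ne: "cexp (z - z0) \<noteq> 1" if "z \<noteq> a" "z \<in> ball a 1" for z
      proof
        assume "cexp (z - z0) = 1"
        then have "z - z0 - (a - z0) \<in> \<int>" using True unfolding cexp_eq_1_iff by (rule Ints_diff)
        then obtain m where m: "z - a = of_int m" by (auto simp: Ints_def)
        have "norm (z - a) < 1" using that by (simp add: dist_norm norm_minus_commute)
        then have "m = 0" using m by simp
        with m that show False by simp
      qed
      obtain e where e: "e > 0" "ball a e \<subseteq> band \<rho> \<inter> ball a 1"
        using openE[OF open_Int[OF open_band open_ball, of \<rho> a 1], of a] a by auto
      have E1n: "E1 z \<noteq> 0" if "z \<in> ball a e" for z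
        using ne[of z] that e True by (auto simp: E1_def dE)
      have "(\<lambda>z. F1 z / E1 z) holomorphic_on ball a e"
        using e E1n by (intro holomorphic_on_divide holomorphic_on_subset[OF F1] holomorphic_on_subset[OF E1]) auto
      then have "g holomorphic_on ball a e"
      proof (rule holomorphic_transform)
        fix z assume z: "z \<in> ball a e"
        show "F1 z / E1 z = g z"
        proof (cases "z = a")
          case True
          then show ?thesis using \<open>cexp (a - z0) = 1\<close> by (simp add: F1_def E1_def g_def dE)
        next
          case False
          then show ?thesis using ne[of z] z e True f_eq[OF True] by (auto simp: F1_def E1_def g_def)
        qed
      qed
      with e show ?thesis by blast
    qed
  qed
  moreover have "g (z + 1) = g z" if z: "z \<in> band \<rho>" for z
  proof -
    have cexp1: "cexp (z + 1 - z0) = cexp (z - z0)"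
      using cexp_add[of "z - z0" 1] cexp_of_int[of 1] by (simp add: algebra_simps)
    have "deriv f (z + 1) = deriv (\<lambda>w. f (w + 1)) z"
      using hf z by (intro DERIV_imp_deriv[symmetric] iffD1[OF DERIV_shift]
          holomorphic_derivI[OF hf open_band]) auto
    also have "\<dots> = deriv f z"
    proof (rule deriv_cong_ev[OF _ refl])
      have "eventually (\<lambda>w. w \<in> band \<rho>) (nhds z)"
        using z open_band by (simp add: eventually_nhds_in_open)
      then show "eventually (\<lambda>w. f (w + 1) = f w) (nhds z)"
        by eventually_elim (use f in \<open>auto simp: periodic_holo_def\<close>)
    qed
    finally have "deriv f (z + 1) = deriv f z" .
    then show ?thesis using f z cexp1 by (simp add: g_def periodic_holo_def)
  qed
  ultimately show ?thesis using that[of g] by (auto simp: periodic_holo_def)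
qed

lemma summable_on_int_exp:
  assumes "c > (0::real)"
  shows "(\<lambda>k::int. exp (- c * of_int \<bar>k\<bar>)) summable_on UNIV"
proof -
  have "exp (- c) < 1" using assms by simp
  then have s: "summable (\<lambda>n. exp (- c) ^ n)" by (intro summable_geometric) simp
  then have s': "(\<lambda>n::nat. exp (- c) ^ n) summable_on UNIV"
    by (intro summable_nonneg_imp_summable_on) auto
  have e: "exp (- c) ^ n = exp (- c * of_int \<bar>int n\<bar>)" "exp (- c) ^ n = exp (- c * of_int \<bar>- int n\<bar>)" for n
    by (simp_all add: exp_of_nat_mult[symmetric] mult.commute)
  have "(\<lambda>k::int. exp (- c * of_int \<bar>k\<bar>)) summable_on range int"
    by (subst summable_on_reindex) (use s' in \<open>auto simp: o_def e(1)\<close>)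
  moreover have "(\<lambda>k::int. exp (- c * of_int \<bar>k\<bar>)) summable_on range (\<lambda>n. - int n)"
    by (subst summable_on_reindex) (use s' in \<open>auto simp: o_def e(2) inj_def\<close>)
  moreover have "range int \<union> range (\<lambda>n. - int n) = UNIV"
  proof -
    have "k \<in> range int \<union> range (\<lambda>n. - int n)" for k by (cases k rule: int_cases2) auto
    then show ?thesis by blast
  qed
  ultimately show ?thesis using summable_on_union by metis
qed

text \<open>Multiplication by cexp z shifts Fourier coefficients by one. Hence the factorisation of
  \<open>f - f z0\<close> turns the k-th term of the series at \<open>z0\<close> into
  \<open>d (k - 1) - d k\<close>, plus \<open>f z0\<close> when k = 0, where \<open>d\<close> is the
  summable family of terms of the series of \<open>g\<close>.\<close>

lemma fourier_inversion:
  assumes f: "periodic_holo \<rho> f" and z0: "z0 \<in> band \<rho>"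
  shows "((\<lambda>k. fcoeff f k * cexp (of_int k * z0)) has_sum f z0) UNIV"
proof -
  have "\<rho> > 0" using z0 by (simp add: band_def)
  obtain g where g: "periodic_holo \<rho> g"
    and fg: "\<And>z. z \<in> band \<rho> \<Longrightarrow> f z - f z0 = (cexp (z - z0) - 1) * g z"
    using fourier_quotient[OF f z0] by blast
  \<comment> \<open>Strictly between |Im z0| and \<rho>: the decay of the coefficients at rate r
    then beats the growth of cexp (k z0).\<close>
  define r where "r = (\<bar>Im z0\<bar> + \<rho>) / 2"
  have r: "0 < r" "r < \<rho>" "\<bar>Im z0\<bar> < r" using z0 by (auto simp: r_def band_def)
  define d where "d = (\<lambda>k. fcoeff g k * cexp (of_int k * z0))"
  have "compact (g ` cbox (Complex 0 (-r)) (Complex 1 r))"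
  proof (rule compact_continuous_image)
    have "g holomorphic_on cbox (Complex 0 (-r)) (Complex 1 r)"
    proof (rule holomorphic_on_subset)
      show "g holomorphic_on band \<rho>" using g unfolding periodic_holo_def by blast
      show "cbox (Complex 0 (-r)) (Complex 1 r) \<subseteq> band \<rho>"
        using r by (auto simp: band_def in_cbox_complex_iff)
    qed
    then show "continuous_on (cbox (Complex 0 (-r)) (Complex 1 r)) g"
      by (rule holomorphic_on_imp_continuous_on)
  qed simp
  then have "bounded (g ` cbox (Complex 0 (-r)) (Complex 1 r))" by (rule compact_imp_bounded)
  then obtain M where M: "\<And>z. z \<in> cbox (Complex 0 (-r)) (Complex 1 r) \<Longrightarrow> norm (g z) \<le> M"
    unfolding bounded_iff by blast
  \<comment> \<open>Only one period of the closed band is compact; periodicity carries the bound to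
    the rest.\<close>
  have M': "norm (g z) \<le> M" if "\<bar>Im z\<bar> \<le> r" for z
  proof -
    define w where "w = z + of_int (- \<lfloor>Re z\<rfloor>)"
    have "w \<in> cbox (Complex 0 (-r)) (Complex 1 r)"
      using that by (auto simp: w_def in_cbox_complex_iff) linarith+
    moreover have "g w = g z"
      unfolding w_def by (rule periodic_holo_add_of_int[OF g]) (use that r in \<open>auto simp: band_def\<close>)
    ultimately show ?thesis using M by metis
  qed
  have dbound: "norm (d k) \<le> M * exp (- (2 * pi * (r - \<bar>Im z0\<bar>)) * of_int \<bar>k\<bar>)" for k
  proof -
    have M0: "M \<ge> 0" using order_trans[OF norm_ge_zero M'[of 0]] r by simp
    have "norm (d k) \<le> M * exp (- 2 * pi * r * of_int \<bar>k\<bar>) * exp (2 * pi * \<bar>Im z0\<bar> * of_int \<bar>k\<bar>)"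
      unfolding d_def norm_mult
    proof (rule mult_mono)
      show "cmod (fcoeff g k) \<le> M * exp (- 2 * pi * r * real_of_int \<bar>k\<bar>)"
        using r by (intro fcoeff_bound[OF g] M') auto
      have "- (of_int k * Im z0) \<le> \<bar>Im z0\<bar> * \<bar>of_int k\<bar>"
        by (metis abs_ge_minus_self abs_mult mult.commute)
      then have "2 * pi * - (of_int k * Im z0) \<le> 2 * pi * (\<bar>Im z0\<bar> * \<bar>of_int k\<bar>)"
        by (intro mult_left_mono) auto
      then show "cmod (cexp (of_int k * z0)) \<le> exp (2 * pi * \<bar>Im z0\<bar> * of_int \<bar>k\<bar>)"
        by (simp add: norm_cexp algebra_simps)
    qed (use M0 in auto)
    also have "\<dots> = M * exp (- (2 * pi * (r - \<bar>Im z0\<bar>)) * of_int \<bar>k\<bar>)"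
      by (simp add: exp_add[symmetric] algebra_simps)
    finally show ?thesis .
  qed
  have "(\<lambda>k::int. M * exp (- (2 * pi * (r - \<bar>Im z0\<bar>)) * of_int \<bar>k\<bar>)) summable_on UNIV"
    using r by (intro summable_on_cmult_right summable_on_int_exp) auto
  then have "d summable_on UNIV"
    by (rule abs_summable_summable[OF summable_on_comparison_test])
       (use dbound in auto)
  then have d: "(d has_sum infsum d UNIV) UNIV" by simp
  \<comment> \<open>The shifted family has the same sum, so the telescoping part below contributes
    0.\<close>
  then have d': "((\<lambda>k. d (k - 1)) has_sum infsum d UNIV) UNIV"
    by (subst has_sum_reindex_bij_witness[of UNIV "\<lambda>k. k + 1" "\<lambda>k. k - 1" UNIV d]) auto
  have delta: "((\<lambda>k::int. if k = 0 then f z0 else 0) has_sum f z0) UNIV"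
    by (rule has_sum_finite_neutralI[of "{0}"]) auto
  have "((\<lambda>k. (if k = 0 then f z0 else 0) + (d (k - 1) + - d k)) has_sum f z0 + (infsum d UNIV + - infsum d UNIV)) UNIV"
    by (rule has_sum_add[OF delta has_sum_add[OF d' has_sum_uminusI[OF d]]])
  \<comment> \<open>Multiply f = f z0 + (cexp (z - z0) - 1) g by cexp (- k z) and take means; the
    mean of the constant's part survives only for k = 0.\<close>
  moreover have "fcoeff f k * cexp (of_int k * z0) = (if k = 0 then f z0 else 0) + (d (k - 1) - d k)" for k
  proof -
    let ?e = "\<lambda>k z. cexp (of_int k * z)"
    have "mean (\<lambda>z. f z * ?e (- k) z) = mean (\<lambda>z. f z0 * ?e (- k) z -
        (?e 0 z * (g z * ?e (- k) z) - cexp (- z0) * (g z * ?e (- (k - 1)) z)))"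
    proof (rule mean_cong[OF _ \<open>\<rho> > 0\<close>])
      fix z assume z: "z \<in> band \<rho>"
      have "f z = f z0 + (cexp (z - z0) - 1) * g z" using fg[OF z] by (simp add: algebra_simps)
      moreover have "cexp (z - z0) * ?e (- k) z = cexp (- z0) * ?e (- (k - 1)) z"
        by (simp add: cexp_add[symmetric] algebra_simps)
      moreover have "(f z0 + (cexp (z - z0) - 1) * g z) * ?e (- k) z =
          f z0 * ?e (- k) z - (g z * ?e (- k) z - cexp (z - z0) * ?e (- k) z * g z)"
        by (simp add: algebra_simps)
      ultimately have "f z * ?e (- k) z =
          f z0 * ?e (- k) z - (g z * ?e (- k) z - cexp (- z0) * ?e (- (k - 1)) z * g z)"
        by simp
      then show "f z * ?e (- k) z = f z0 * ?e (- k) z -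
        (?e 0 z * (g z * ?e (- k) z) - cexp (- z0) * (g z * ?e (- (k - 1)) z))"
        by (simp add: mult_ac)
    qed
    also have "\<dots> = f z0 * (if k = 0 then 1 else 0) - (fcoeff g k - cexp (- z0) * fcoeff g (k - 1))"
    proof -
      have 1: "periodic_holo \<rho> (\<lambda>z. g z * ?e j z)" for j
        by (intro periodic_holo_mult g periodic_holo_cexp)
      have 2: "periodic_holo \<rho> (\<lambda>z. ?e 0 z * (g z * ?e (- k) z))"
        by (intro periodic_holo_mult 1 periodic_holo_cexp)
      have 3: "periodic_holo \<rho> (\<lambda>z. cexp (- z0) * (g z * ?e (- (k - 1)) z))"
        by (intro periodic_holo_mult 1 periodic_holo_const)
      have 4: "periodic_holo \<rho> (\<lambda>z. f z0 * ?e (- k) z)"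
        by (intro periodic_holo_mult periodic_holo_const periodic_holo_cexp)
      show ?thesis
        unfolding mean_diff[OF 4 periodic_holo_diff[OF 2 3] \<open>\<rho> > 0\<close>] mean_diff[OF 2 3 \<open>\<rho> > 0\<close>]
          mean_cmult[OF 1 \<open>\<rho> > 0\<close>] mean_cmult[OF periodic_holo_cexp \<open>\<rho> > 0\<close>] mean_cexp
        by (simp add: fcoeff_def)
    qed
    finally have A: "fcoeff f k = f z0 * (if k = 0 then 1 else 0) - (fcoeff g k - cexp (- z0) * fcoeff g (k - 1))"
      by (simp add: fcoeff_def)
    have B: "cexp (- z0) * cexp (of_int k * z0) = cexp (of_int (k - 1) * z0)"
      by (simp add: cexp_add[symmetric] algebra_simps)
    have "fcoeff f k * cexp (of_int k * z0) = f z0 * (if k = 0 then 1 else 0) * cexp (of_int k * z0) +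
        (fcoeff g (k - 1) * (cexp (- z0) * cexp (of_int k * z0)) - fcoeff g k * cexp (of_int k * z0))"
      unfolding A by (simp only: ring_distribs mult_ac) simp
    then show ?thesis unfolding B d_def by auto
  qed
  ultimately show ?thesis by simp
qed

section \<open>Fourier coefficients in one of several variables\<close>

text \<open>The error depends on \<open>f\<close> only through the bound \<open>M\<close>, which
  makes the approximation uniform in any parameter of \<open>f\<close>. By Cauchy's inequality
  \<open>f\<close> is Lipschitz on the real line with constant M / r, so each of the N steps
  contributes at most M / r / N^2.\<close>

lemma riemann_mean:
  assumes f: "periodic_holo \<rho> f" and r: "0 < r" "r < \<rho>"
    and M: "\<And>z. \<bar>Im z\<bar> \<le> r \<Longrightarrow> norm (f z) \<le> M" and N: "N > 0"
  shows "norm (mean f - (\<Sum>j<N. f (of_real (real j / real N))) / of_nat N) \<le> M / r / real N"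
proof -
  have "\<rho> > 0" using r by simp
  have hf: "f holomorphic_on band \<rho>" using f by (simp add: periodic_holo_def)
  obtain P where P: "\<And>z. z \<in> band \<rho> \<Longrightarrow> (P has_field_derivative f z) (at z)"
    "\<And>z. z \<in> band \<rho> \<Longrightarrow> P (z + 1) - P z = mean f"
    using periodic_holo_primitive[OF f \<open>\<rho> > 0\<close>] by blast
  have real_band: "z \<in> band \<rho>" if "z \<in> \<real>" for z
    using that \<open>\<rho> > 0\<close> by (auto simp: band_def elim!: Reals_cases)
  have df: "norm (deriv f z) \<le> M / r" if "z \<in> \<real>" for z
  proof -
    have Im: "Im z = 0" using that by (auto elim!: Reals_cases)
    have sub: "cball z r \<subseteq> band \<rho>" using Im r by (intro cball_subset_band) simp
    have "norm ((deriv ^^ 1) f z) \<le> fact 1 * M / r ^ 1"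
    proof (rule Cauchy_inequality)
      show "f holomorphic_on ball z r" using sub ball_subset_cball hf by (meson holomorphic_on_subset order_trans)
      show "continuous_on (cball z r) f"
        using sub hf by (meson holomorphic_on_imp_continuous_on holomorphic_on_subset)
      fix x assume "norm (z - x) = r"
      then show "norm (f x) \<le> M"
        using abs_Im_le_cmod[of "z - x"] Im by (intro M) simp
    qed (use r in auto)
    then show ?thesis by simp
  qed
  have M0: "M \<ge> 0" using order_trans[OF norm_ge_zero M[of 0]] r by simp
  have conv: "convex (\<real> :: complex set)"
    by (intro convexI) (auto simp: scaleR_conv_of_real)
  have lip: "norm (f x - f y) \<le> M / r * norm (x - y)" if "x \<in> \<real>" "y \<in> \<real>" for x y
    using conv
  proof (rule field_differentiable_bound)
    fix z :: complex assume z: "z \<in> \<real>"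
    show "(f has_field_derivative deriv f z) (at z within \<real>)"
      using holomorphic_derivI[OF hf open_band real_band[OF z]] by (rule has_field_derivative_at_within)
    show "norm (deriv f z) \<le> M / r" using df[OF z] .
  qed (use that in auto)
  define x where "x j = (of_real (real j / real N) :: complex)" for j
  have xR: "x j \<in> \<real>" for j by (simp add: x_def)
  have xs: "x (Suc j) - x j = 1 / of_nat N" for j
    using N by (simp add: x_def field_simps)
  have step: "norm (P (x (Suc j)) - P (x j) - f (x j) / of_nat N) \<le> M / r / (real N)^2" for j
  proof -
    have seg: "closed_segment (x j) (x (Suc j)) \<subseteq> \<real>"
      by (rule closed_segment_subset[OF xR xR conv])
    \<comment> \<open>Its derivative is \<open>f z - f (x j)\<close>, so its increment over the
      segment is the error of one step.\<close>
    let ?g = "\<lambda>z. P z - f (x j) * z"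
    have "norm (?g (x (Suc j)) - ?g (x j)) \<le> (M / r / real N) * norm (x (Suc j) - x j)"
      using convex_closed_segment[of "x j" "x (Suc j)"]
    proof (rule field_differentiable_bound)
      fix z assume z: "z \<in> closed_segment (x j) (x (Suc j))"
      then have zR: "z \<in> \<real>" using seg by auto
      have "(?g has_field_derivative f z - f (x j) * 1) (at z)"
        by (intro DERIV_diff DERIV_cmult DERIV_ident P(1) real_band zR)
      then show "(?g has_field_derivative f z - f (x j)) (at z within closed_segment (x j) (x (Suc j)))"
        by (simp add: has_field_derivative_at_within)
      have "norm (f z - f (x j)) \<le> M / r * norm (z - x j)" by (rule lip[OF zR xR])
      also have "\<dots> \<le> M / r * norm (x (Suc j) - x j)"
        using segment_bound(1)[OF z] M0 r by (intro mult_left_mono) (auto simp: norm_minus_commute)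
      also have "\<dots> = M / r / real N" unfolding xs by (simp add: norm_divide)
      finally show "norm (f z - f (x j)) \<le> M / r / real N" .
    qed auto
    also have "?g (x (Suc j)) - ?g (x j) = P (x (Suc j)) - P (x j) - f (x j) * (x (Suc j) - x j)"
      by (simp add: algebra_simps)
    finally show ?thesis unfolding xs by (simp add: norm_divide power2_eq_square)
  qed
  have "mean f = P (x N) - P (x 0)"
    using P(2)[of 0] N real_band[of 0] by (simp add: x_def)
  also have "\<dots> = (\<Sum>j<N. P (x (Suc j)) - P (x j))"
    by (rule sum_lessThan_telescope[symmetric])
  finally have "mean f - (\<Sum>j<N. f (x j)) / of_nat N = (\<Sum>j<N. P (x (Suc j)) - P (x j) - f (x j) / of_nat N)"
    by (simp add: sum_subtractf sum_divide_distrib)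
  also have "norm \<dots> \<le> (\<Sum>j<N. M / r / (real N)^2)"
    by (intro sum_norm_le step)
  also have "\<dots> = M / r / real N" using N by (simp add: power2_eq_square)
  finally show ?thesis by (simp add: x_def)
qed

text \<open>In place of differentiation under the integral: Riemann sums are finite sums of
  functions holomorphic in \<open>w\<close>, and by \<open>riemann_mean\<close> they converge
  uniformly on closed discs.\<close>

lemma holomorphic_mean:
  assumes G1: "\<And>w. w \<in> band \<rho> \<Longrightarrow> periodic_holo \<rho> (G w)"
    and G2: "\<And>t. t \<in> band \<rho> \<Longrightarrow> (\<lambda>w. G w t) holomorphic_on band \<rho>"
    and bnd: "\<And>r. 0 < r \<Longrightarrow> r < \<rho> \<Longrightarrow> \<exists>M. \<forall>w t. \<bar>Im w\<bar> \<le> r \<longrightarrow> \<bar>Im t\<bar> \<le> r \<longrightarrow> norm (G w t) \<le> M"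
  shows "(\<lambda>w. mean (G w)) holomorphic_on band \<rho>"
proof (rule holomorphic_uniform_sequence[OF open_band])
  \<comment> \<open>\<open>Suc N\<close> nodes, so that every term of the sequence satisfies the
    positivity condition of \<open>riemann_mean\<close>.\<close>
  let ?A = "\<lambda>N w. (\<Sum>j<Suc N. G w (of_real (real j / real (Suc N)))) / of_nat (Suc N)"
  show "?A N holomorphic_on band \<rho>" for N
  proof (cases "\<rho> > 0")
    case True
    then show ?thesis by (intro holomorphic_intros G2) (auto simp: band_def)
  next
    case False
    then have "band \<rho> = {}" by (auto simp: band_def)
    then show ?thesis by (simp add: holomorphic_on_def)
  qed
  fix w0 assume w0: "w0 \<in> band \<rho>"
  define d where "d = (\<rho> - \<bar>Im w0\<bar>) / 2"
  define r where "r = (\<rho> + \<bar>Im w0\<bar>) / 2"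
  have d: "d > 0" "\<bar>Im w0\<bar> + d < \<rho>" and r: "0 < r" "r < \<rho>" "\<bar>Im w0\<bar> + d = r"
    using w0 by (auto simp: d_def r_def band_def field_simps)
  obtain M where M: "\<And>w t. \<bar>Im w\<bar> \<le> r \<Longrightarrow> \<bar>Im t\<bar> \<le> r \<Longrightarrow> norm (G w t) \<le> M"
    using bnd[OF r(1,2)] by blast
  have M0: "M \<ge> 0" using order_trans[OF norm_ge_zero M[of 0 0]] r by simp
  have "uniform_limit (cball w0 d) ?A (\<lambda>w. mean (G w)) sequentially"
  proof (rule uniform_limitI)
    fix e :: real assume "e > 0"
    have "((\<lambda>N. M / r * inverse (real (Suc N))) \<longlongrightarrow> M / r * 0) sequentially"
      by (intro tendsto_mult tendsto_const LIMSEQ_inverse_real_of_nat)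
    then have "((\<lambda>N. M / r / real (Suc N)) \<longlongrightarrow> 0) sequentially"
      by (simp add: field_simps)
    then have "eventually (\<lambda>N. M / r / real (Suc N) < e) sequentially"
      using \<open>e > 0\<close> by (rule order_tendstoD)
    then show "eventually (\<lambda>N. \<forall>w\<in>cball w0 d. dist (?A N w) (mean (G w)) < e) sequentially"
    proof eventually_elim
      case (elim N)
      show ?case
      proof
        fix w assume w: "w \<in> cball w0 d"
        have "\<bar>Im w\<bar> \<le> r" using w abs_Im_le_cmod[of "w0 - w"] r(3) by (simp add: dist_norm)
        then have "norm (mean (G w) - ?A N w) \<le> M / r / real (Suc N)"
          using r by (intro riemann_mean[of \<rho>] G1 M) (auto simp: band_def)
        then show "dist (?A N w) (mean (G w)) < e"
          using elim by (simp add: dist_norm norm_minus_commute)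
      qed
    qed
  qed
  then show "\<exists>d>0. cball w0 d \<subseteq> band \<rho> \<and> uniform_limit (cball w0 d) ?A (\<lambda>w. mean (G w)) sequentially"
    using d cball_subset_band by blast
qed

section \<open>Separate analyticity on strips and coefficients in one coordinate\<close>

definition cstrip :: "real \<Rightarrow> (complex^'m) set" where
  "cstrip r = {\<theta>. \<forall>i. \<bar>Im (\<theta> $ i)\<bar> \<le> r}"

definition upd :: "'a^'m \<Rightarrow> 'm \<Rightarrow> 'a \<Rightarrow> 'a^'m" where
  "upd \<theta> i t = (\<chi> j. if j = i then t else \<theta> $ j)"

lemma upd_nth [simp]: "upd \<theta> i t $ j = (if j = i then t else \<theta> $ j)"
  by (simp add: upd_def)

lemma upd_upd [simp]: "upd (upd \<theta> i t) i s = upd \<theta> i s"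
  and upd_same [simp]: "upd \<theta> i (\<theta> $ i) = \<theta>"
  by (auto simp: vec_eq_iff)

lemma upd_commute: "i \<noteq> j \<Longrightarrow> upd (upd \<theta> i t) j s = upd (upd \<theta> j s) i t"
  by (auto simp: vec_eq_iff)

lemma upd_in_strip: "\<theta> \<in> strip \<rho> \<Longrightarrow> t \<in> band \<rho> \<Longrightarrow> upd \<theta> i t \<in> strip \<rho>"
  by (auto simp: strip_def band_def)

lemma nth_in_band: "\<theta> \<in> strip \<rho> \<Longrightarrow> \<theta> $ i \<in> band \<rho>"
  by (auto simp: strip_def band_def)

lemma upd_in_cstrip: "\<theta> \<in> cstrip r \<Longrightarrow> \<bar>Im t\<bar> \<le> r \<Longrightarrow> upd \<theta> i t \<in> cstrip r"
  by (auto simp: cstrip_def)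

lemma cstrip_subset_strip: "r < \<rho> \<Longrightarrow> cstrip r \<subseteq> strip \<rho>"
  by (auto simp: strip_def cstrip_def intro: le_less_trans)

text \<open>Uniform bounds are available on closed strips only; since there are finitely many
  coordinates, every point of the open strip lies in one of them.\<close>

lemma strip_imp_cstrip:
  fixes \<theta> :: "complex^'m"
  assumes "\<theta> \<in> strip \<rho>"
  obtains r where "0 \<le> r" "r < \<rho>" "\<theta> \<in> cstrip r"
proof
  let ?r = "Max (range (\<lambda>i. \<bar>Im (\<theta> $ i)\<bar>))"
  have le: "\<bar>Im (\<theta> $ i)\<bar> \<le> ?r" for i by (intro Max_ge) auto
  then show "\<theta> \<in> cstrip ?r" by (simp add: cstrip_def)
  show "0 \<le> ?r" using order_trans[OF abs_ge_zero le] .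
  show "?r < \<rho>" using assms by (subst Max_less_iff) (auto simp: strip_def)
qed

text \<open>A class that is closed under taking the coefficient in one coordinate. The bounds on
  closed strips stand in for joint continuity and feed the uniform bound that
  \<open>holomorphic_mean\<close> asks for.\<close>

definition separately_analytic :: "real \<Rightarrow> (complex^'m \<Rightarrow> complex) \<Rightarrow> bool" where
  "separately_analytic \<rho> F \<longleftrightarrow> (\<forall>\<theta>\<in>strip \<rho>. \<forall>i. periodic_holo \<rho> (\<lambda>t. F (upd \<theta> i t))) \<and>
     (\<forall>r. 0 \<le> r \<longrightarrow> r < \<rho> \<longrightarrow> (\<exists>M. \<forall>\<theta>\<in>cstrip r. norm (F \<theta>) \<le> M))"

text \<open>Kept as a function of all coordinates, constant in coordinate \<open>i\<close>, so that
  the extraction can be repeated without changing the type.\<close>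

definition sep_coeff :: "'m \<Rightarrow> int \<Rightarrow> (complex^'m \<Rightarrow> complex) \<Rightarrow> complex^'m \<Rightarrow> complex" where
  "sep_coeff i k F \<theta> = fcoeff (\<lambda>t. F (upd \<theta> i t)) k"

lemma sep_coeff_bound:
  assumes F: "separately_analytic \<rho> F" and r: "0 \<le> r" "r < \<rho>" and M: "\<And>\<theta>. \<theta> \<in> cstrip r \<Longrightarrow> norm (F \<theta>) \<le> M"
    and \<theta>: "\<theta> \<in> cstrip r"
  shows "norm (sep_coeff i k F \<theta>) \<le> M * exp (- 2 * pi * r * of_int \<bar>k\<bar>)"
  unfolding sep_coeff_def
proof (rule fcoeff_bound[OF _ r])
  show "periodic_holo \<rho> (\<lambda>t. F (upd \<theta> i t))"
    using F \<theta> cstrip_subset_strip[OF r(2)] unfolding separately_analytic_def by blast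
qed (use M upd_in_cstrip[OF \<theta>] in auto)

text \<open>In coordinate \<open>i\<close> the coefficient is constant. In any other coordinate it
  is a mean with a holomorphic parameter.\<close>

lemma separately_analytic_sep_coeff:
  fixes F :: "complex^'m \<Rightarrow> complex"
  assumes F: "separately_analytic \<rho> F"
  shows "separately_analytic \<rho> (sep_coeff i k F)"
  unfolding separately_analytic_def
proof (intro conjI ballI allI impI)
  have F1: "periodic_holo \<rho> (\<lambda>t. F (upd \<theta> i t))" if "\<theta> \<in> strip \<rho>" for \<theta> i
    using F that by (simp add: separately_analytic_def)
  fix \<theta> :: "complex^'m" and j
  assume \<theta>: "\<theta> \<in> strip \<rho>"
  show "periodic_holo \<rho> (\<lambda>t. sep_coeff i k F (upd \<theta> j t))"
  proof (cases "j = i")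
    case True
    then show ?thesis by (simp add: sep_coeff_def)
  next
    case False
    have "(\<lambda>w. mean (\<lambda>t. F (upd (upd \<theta> j w) i t) * cexp (of_int (- k) * t))) holomorphic_on band \<rho>"
    proof (rule holomorphic_mean)
      fix w assume "w \<in> band \<rho>"
      then show "periodic_holo \<rho> (\<lambda>t. F (upd (upd \<theta> j w) i t) * cexp (of_int (- k) * t))"
        by (intro periodic_holo_mult F1 upd_in_strip \<theta> periodic_holo_cexp)
    next
      fix t assume t: "t \<in> band \<rho>"
      have "(\<lambda>w. F (upd (upd \<theta> i t) j w)) holomorphic_on band \<rho>"
        using F1[OF upd_in_strip[OF \<theta> t]] unfolding periodic_holo_def by blast
      then show "(\<lambda>w. F (upd (upd \<theta> j w) i t) * cexp (of_int (- k) * t)) holomorphic_on band \<rho>"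
        using False by (intro holomorphic_intros) (simp add: upd_commute)
    next
      fix r assume r: "0 < r" "r < \<rho>"
      obtain r0 where r0: "0 \<le> r0" "r0 < \<rho>" "\<theta> \<in> cstrip r0" using strip_imp_cstrip[OF \<theta>] by blast
      \<comment> \<open>One closed strip for the two moving coordinates, of height \<open>r\<close>,
        and the fixed coordinates of \<theta>, of height \<open>r0\<close>.\<close>
      define r1 where "r1 = max r r0"
      have r1: "0 \<le> r1" "r1 < \<rho>" "r \<le> r1" "\<theta> \<in> cstrip r1"
        using r r0 by (auto simp: r1_def cstrip_def intro: order_trans)
      obtain M where M: "\<And>\<theta>. \<theta> \<in> cstrip r1 \<Longrightarrow> norm (F \<theta>) \<le> M"
        using F r1(1,2) unfolding separately_analytic_def by blast
      have M0: "M \<ge> 0" using order_trans[OF norm_ge_zero M[OF r1(4)]] .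
      show "\<exists>M. \<forall>w t. \<bar>Im w\<bar> \<le> r \<longrightarrow> \<bar>Im t\<bar> \<le> r \<longrightarrow>
          norm (F (upd (upd \<theta> j w) i t) * cexp (of_int (- k) * t)) \<le> M"
      proof (intro exI allI impI)
        fix w t :: complex assume wt: "\<bar>Im w\<bar> \<le> r" "\<bar>Im t\<bar> \<le> r"
        have "norm (cexp (of_int (- k) * t)) \<le> exp (2 * pi * (\<bar>of_int k\<bar> * r))"
        proof -
          have "of_int k * Im t \<le> \<bar>of_int k\<bar> * \<bar>Im t\<bar>" by (metis abs_ge_self abs_mult)
          also have "\<dots> \<le> \<bar>of_int k\<bar> * r" using wt by (intro mult_left_mono) auto
          finally have "2 * pi * (of_int k * Im t) \<le> 2 * pi * (\<bar>of_int k\<bar> * r)" by (intro mult_left_mono) auto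
          then show ?thesis by (simp add: norm_cexp)
        qed
        then show "norm (F (upd (upd \<theta> j w) i t) * cexp (of_int (- k) * t)) \<le> M * exp (2 * pi * (\<bar>of_int k\<bar> * r))"
          unfolding norm_mult using wt r1 M0 by (intro mult_mono M upd_in_cstrip) auto
      qed
    qed
    moreover have "F (upd (upd \<theta> j (w + 1)) i t) = F (upd (upd \<theta> j w) i t)" if "w \<in> band \<rho>" "t \<in> band \<rho>" for w t
      using F1[OF upd_in_strip[OF \<theta> that(2)], of i j] that(1) False unfolding periodic_holo_def
      by (simp add: upd_commute)
    then have "mean (\<lambda>t. F (upd (upd \<theta> j (w + 1)) i t) * cexp (of_int (- k) * t)) =
        mean (\<lambda>t. F (upd (upd \<theta> j w) i t) * cexp (of_int (- k) * t))" if "w \<in> band \<rho>" for w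
      using that by (intro mean_cong[of \<rho>]) (auto simp: band_def)
    ultimately show ?thesis unfolding sep_coeff_def fcoeff_def periodic_holo_def by blast
  qed
next
  fix r assume r: "0 \<le> r" "r < \<rho>"
  then obtain M where M: "\<And>\<theta>. \<theta> \<in> cstrip r \<Longrightarrow> norm (F \<theta>) \<le> M"
    using F unfolding separately_analytic_def by blast
  then show "\<exists>M. \<forall>\<theta>\<in>cstrip r. norm (sep_coeff i k F \<theta>) \<le> M"
    using sep_coeff_bound[OF F r M] by blast
qed

section \<open>Fourier series in several variables\<close>

definition kdot :: "int^'m \<Rightarrow> complex^'m \<Rightarrow> complex" where
  "kdot k \<theta> = (\<Sum>i\<in>UNIV. of_int (k $ i) * \<theta> $ i)"

lemma kdot_add: "kdot k (\<theta> + \<phi>) = kdot k \<theta> + kdot k \<phi>"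
  by (simp add: kdot_def ring_distribs sum.distrib)

lemma kdot_scale: "kdot k (c *s \<theta>) = c * kdot k \<theta>"
  by (simp add: kdot_def sum_distrib_left mult_ac)

lemma kdot_minus: "kdot k (- \<theta>) = - kdot k \<theta>" "kdot (- k) \<theta> = - kdot k \<theta>"
  by (simp_all add: kdot_def sum_negf)

lemma l1_nonneg: "l1 k \<ge> 0"
  by (simp add: l1_def sum_nonneg)

lemma l1_minus: "l1 (- k) = l1 k"
  by (simp add: l1_def)

lemma norm_cexp_kdot:
  assumes "\<theta> \<in> cstrip r"
  shows "norm (cexp (kdot k \<theta>)) \<le> exp (2 * pi * r * of_int (l1 k))"
proof -
  have "- Im (kdot k \<theta>) = (\<Sum>i\<in>UNIV. - (of_int (k $ i) * Im (\<theta> $ i)))"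
    by (simp add: kdot_def sum_negf)
  also have "\<dots> \<le> (\<Sum>i\<in>UNIV. of_int \<bar>k $ i\<bar> * r)"
  proof (rule sum_mono)
    fix i
    have "- (of_int (k $ i) * Im (\<theta> $ i)) \<le> of_int \<bar>k $ i\<bar> * \<bar>Im (\<theta> $ i)\<bar>"
      by (metis abs_ge_minus_self abs_mult of_int_abs)
    also have "\<dots> \<le> of_int \<bar>k $ i\<bar> * r"
      using assms by (intro mult_left_mono) (auto simp: cstrip_def)
    finally show "- (of_int (k $ i) * Im (\<theta> $ i)) \<le> of_int \<bar>k $ i\<bar> * r" .
  qed
  also have "\<dots> = r * of_int (l1 k)"
    by (simp add: l1_def sum_distrib_left mult.commute)
  finally have "2 * pi * (- Im (kdot k \<theta>)) \<le> 2 * pi * (r * of_int (l1 k))"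
    by (intro mult_left_mono) auto
  then show ?thesis by (simp add: norm_cexp)
qed

text \<open>The exponential of the l1 norm is a product over the coordinates, which reduces the
  lattice sum to the one-dimensional one. The product rule is stated for the set-sum notion of
  absolute summability, hence the passage there and back.\<close>

lemma summable_on_exp_l1:
  assumes c: "c > (0::real)"
  shows "(\<lambda>k::int^'m. exp (- c * of_int (l1 k))) summable_on UNIV"
proof -
  let ?f = "\<lambda>j::int. exp (- c * of_int \<bar>j\<bar>)"
  have "?f summable_on UNIV" by (rule summable_on_int_exp[OF c])
  then have "Infinite_Sum.abs_summable_on ?f UNIV" by simp
  then have "Infinite_Set_Sum.abs_summable_on ?f UNIV" by (simp only: abs_summable_equivalent)
  then have "Infinite_Set_Sum.abs_summable_on (\<lambda>g. \<Prod>i\<in>(UNIV::'m set). ?f (g i)) (PiE UNIV (\<lambda>_. UNIV))"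
    by (intro abs_summable_on_prod_PiE) auto
  then have "Infinite_Sum.abs_summable_on (\<lambda>g. \<Prod>i\<in>(UNIV::'m set). ?f (g i)) (PiE UNIV (\<lambda>_. UNIV))"
    by (simp only: abs_summable_equivalent)
  moreover have "norm (\<Prod>i\<in>(UNIV::'m set). ?f (g i)) = exp (- c * of_int (l1 (vec_lambda g)))" for g
    by (simp add: l1_def exp_sum[symmetric] sum_negf[symmetric] sum_distrib_left prod_norm[symmetric])
  ultimately have "(\<lambda>g. exp (- c * of_int (l1 (vec_lambda g :: int^'m)))) summable_on UNIV"
    by simp
  then show ?thesis
    by (subst (asm) summable_on_reindex_bij_witness[of UNIV vec_nth vec_lambda UNIV "\<lambda>k. exp (- c * of_int (l1 k))"]) auto
qed

lemma fourier_summable: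
  fixes a :: "int^'m \<Rightarrow> complex"
  assumes a: "\<And>k. norm (a k) \<le> M * exp (- 2 * pi * r * of_int (l1 k))" and s: "\<theta> \<in> cstrip s" "s < r"
  shows "(\<lambda>k. norm (a k * cexp (kdot k \<theta>))) summable_on UNIV"
proof (rule summable_on_comparison_test)
  show "(\<lambda>k::int^'m. M * exp (- (2 * pi * (r - s)) * of_int (l1 k))) summable_on UNIV"
    using s by (intro summable_on_cmult_right summable_on_exp_l1) auto
  fix k :: "int^'m"
  have "0 \<le> M * exp (- 2 * pi * r * of_int (l1 k))"
    using order_trans[OF norm_ge_zero a] .
  then have "norm (a k * cexp (kdot k \<theta>)) \<le> M * exp (- 2 * pi * r * of_int (l1 k)) * exp (2 * pi * s * of_int (l1 k))"
    unfolding norm_mult by (intro mult_mono a norm_cexp_kdot s) auto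
  also have "\<dots> = M * exp (- (2 * pi * (r - s)) * of_int (l1 k))"
    by (simp add: exp_add[symmetric] algebra_simps)
  finally show "norm (a k * cexp (kdot k \<theta>)) \<le> M * exp (- (2 * pi * (r - s)) * of_int (l1 k))" .
qed simp

lemma l1_upd: "l1 k = \<bar>k $ i\<bar> + l1 (upd k i 0)"
proof -
  have "l1 k = \<bar>k $ i\<bar> + (\<Sum>j\<in>UNIV - {i}. \<bar>k $ j\<bar>)"
    unfolding l1_def by (rule sum.remove) auto
  also have "(\<Sum>j\<in>UNIV - {i}. \<bar>k $ j\<bar>) = (\<Sum>j\<in>UNIV - {i}. \<bar>upd k i 0 $ j\<bar>)"
    by (intro sum.cong) auto
  also have "\<dots> = l1 (upd k i 0)"
    unfolding l1_def by (intro sum.mono_neutral_left) auto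
  finally show ?thesis .
qed

lemma kdot_upd: "kdot k \<theta> = of_int (k $ i) * \<theta> $ i + kdot (upd k i 0) \<theta>"
proof -
  have "kdot k \<theta> = of_int (k $ i) * \<theta> $ i + (\<Sum>j\<in>UNIV - {i}. of_int (k $ j) * \<theta> $ j)"
    unfolding kdot_def by (rule sum.remove) auto
  also have "(\<Sum>j\<in>UNIV - {i}. of_int (k $ j) * \<theta> $ j) = (\<Sum>j\<in>UNIV - {i}. of_int (upd k i 0 $ j) * \<theta> $ j)"
    by (intro sum.cong) auto
  also have "\<dots> = kdot (upd k i 0) \<theta>"
    unfolding kdot_def by (intro sum.mono_neutral_left) auto
  finally show ?thesis .
qed

text \<open>The invariant of an induction over the coordinates in \<open>S\<close>. The support
  condition leaves the remaining entries of the frequency free for later expansions. The bound is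
  required for every admissible \<open>M\<close>, not up to a constant, so that an \<open>M\<close>
  that is already small in one entry of the frequency can be inserted.\<close>

definition fourier_rep :: "real \<Rightarrow> 'm set \<Rightarrow> (complex^'m \<Rightarrow> complex) \<Rightarrow> (int^'m \<Rightarrow> complex) \<Rightarrow> bool" where
  "fourier_rep \<rho> S F a \<longleftrightarrow> (\<forall>k i. a k \<noteq> 0 \<longrightarrow> i \<notin> S \<longrightarrow> k $ i = 0) \<and>
    (\<forall>r M k. 0 \<le> r \<longrightarrow> r < \<rho> \<longrightarrow> (\<forall>\<theta>\<in>cstrip r. norm (F \<theta>) \<le> M) \<longrightarrow>
       norm (a k) \<le> M * exp (- 2 * pi * r * of_int (l1 k))) \<and>
    (\<forall>\<theta>\<in>strip \<rho>. ((\<lambda>k. a k * cexp (kdot k \<theta>)) has_sum F \<theta>) UNIV)"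

text \<open>For a new coordinate \<open>i\<close>, expand in it first. The coefficients
  \<open>C j\<close> depend only on the coordinates in \<open>S\<close>, so the induction hypothesis
  expands each of them, and the iterated sum is recombined into one sum over frequencies.\<close>

lemma multi_fourier_partial:
  fixes F :: "complex^'m \<Rightarrow> complex"
  assumes "finite S" "\<rho> > 0" "separately_analytic \<rho> F"
    and "\<And>\<theta> \<phi>. \<theta> \<in> strip \<rho> \<Longrightarrow> \<phi> \<in> strip \<rho> \<Longrightarrow> (\<And>i. i \<in> S \<Longrightarrow> \<theta> $ i = \<phi> $ i) \<Longrightarrow> F \<theta> = F \<phi>"
  shows "\<exists>a. fourier_rep \<rho> S F a"
  using assms(1,3,4)
proof (induction S arbitrary: F rule: finite_induct)
  case empty
  have Z: "0 \<in> strip \<rho>" "0 \<in> cstrip r" if "0 \<le> r" for r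
    using \<open>\<rho> > 0\<close> that by (auto simp: strip_def cstrip_def)
  have Z1: "0 \<in> strip \<rho>" using \<open>\<rho> > 0\<close> by (auto simp: strip_def)
  define a where "a = (\<lambda>k :: int^'m. if k = 0 then F 0 else 0)"
  show ?case
    unfolding fourier_rep_def
  proof (intro exI[of _ a] conjI allI impI ballI)
    fix r M k assume "0 \<le> r" "r < \<rho>" and M: "\<forall>\<theta>\<in>cstrip r. norm (F \<theta>) \<le> M"
    then have F0: "norm (F 0) \<le> M" using Z by blast
    have "0 \<le> M" using order_trans[OF norm_ge_zero F0] .
    with F0 show "norm (a k) \<le> M * exp (- 2 * pi * r * of_int (l1 k))"
      by (auto simp: a_def l1_def)
  next
    fix \<theta> :: "complex^'m" assume "\<theta> \<in> strip \<rho>"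
    then have "F \<theta> = F 0" using empty.prems(2)[of \<theta> 0] Z1 by blast
    then show "((\<lambda>k. a k * cexp (kdot k \<theta>)) has_sum F \<theta>) UNIV"
      by (intro has_sum_finite_neutralI[of "{0}"]) (auto simp: a_def kdot_def)
  qed (auto simp: a_def split: if_splits)
next
  case (insert i S)
  define C where "C j = sep_coeff i j F" for j
  have F1: "periodic_holo \<rho> (\<lambda>t. F (upd \<theta> i t))" if "\<theta> \<in> strip \<rho>" for \<theta>
    using insert.prems(1) that by (simp add: separately_analytic_def)
  have sepC: "separately_analytic \<rho> (C j)" for j
    unfolding C_def by (intro separately_analytic_sep_coeff insert.prems)
  have depC: "C j \<theta> = C j \<phi>" if "\<theta> \<in> strip \<rho>" "\<phi> \<in> strip \<rho>" "\<And>l. l \<in> S \<Longrightarrow> \<theta> $ l = \<phi> $ l" for j \<theta> \<phi>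
    unfolding C_def sep_coeff_def fcoeff_def
  proof (rule mean_cong[OF _ \<open>\<rho> > 0\<close>])
    fix z assume "z \<in> band \<rho>"
    then have "F (upd \<theta> i z) = F (upd \<phi> i z)"
      by (intro insert.prems(2) upd_in_strip that(1,2)) (auto simp: that(3))
    then show "F (upd \<theta> i z) * cexp (of_int (- j) * z) = F (upd \<phi> i z) * cexp (of_int (- j) * z)" by simp
  qed
  have "\<exists>b. fourier_rep \<rho> S (C j) b" for j
    by (rule insert.IH[OF sepC]) (rule depC)
  then obtain b where b: "\<And>j. fourier_rep \<rho> S (C j) (b j)" by metis
  have b0: "k $ i = 0" if "b j k \<noteq> 0" "i \<notin> S" for j i and k :: "int^'m"
    using b[of j] that unfolding fourier_rep_def by blast
  have b1: "norm (b j k) \<le> M * exp (- 2 * pi * r * of_int (l1 k))"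
    if "0 \<le> r" "r < \<rho>" "\<And>\<theta>. \<theta> \<in> cstrip r \<Longrightarrow> norm (C j \<theta>) \<le> M" for j r M k
    using b[of j] that unfolding fourier_rep_def by blast
  have b2: "((\<lambda>k. b j k * cexp (kdot k \<theta>)) has_sum C j \<theta>) UNIV" if "\<theta> \<in> strip \<rho>" for j \<theta>
    using b[of j] that unfolding fourier_rep_def by blast
  \<comment> \<open>\<open>b j\<close> lives on frequencies with i-th entry 0, so this entry can
    record \<open>j\<close>.\<close>
  define a where "a = (\<lambda>k. b (k $ i) (upd k i 0))"
  have a_bound: "norm (a k) \<le> M * exp (- 2 * pi * r * of_int (l1 k))"
    if r: "0 \<le> r" "r < \<rho>" and M: "\<And>\<theta>. \<theta> \<in> cstrip r \<Longrightarrow> norm (F \<theta>) \<le> M" for r M k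
  proof -
    \<comment> \<open>The bound on \<open>C (k $ i)\<close> from \<open>sep_coeff_bound\<close>
      takes the place of \<open>M\<close> in the induction hypothesis; the two exponentials multiply
      to the one for \<open>l1 k\<close>.\<close>
    have "norm (a k) \<le> (M * exp (- 2 * pi * r * of_int \<bar>k $ i\<bar>)) * exp (- 2 * pi * r * of_int (l1 (upd k i 0)))"
      unfolding a_def
      by (intro b1 r) (use sep_coeff_bound[OF insert.prems(1) r M] in \<open>auto simp: C_def\<close>)
    also have "\<dots> = M * exp (- 2 * pi * r * of_int (l1 k))"
      by (subst l1_upd[of k i]) (simp add: exp_add[symmetric] algebra_simps)
    finally show ?thesis .
  qed
  show ?case
    unfolding fourier_rep_def
  proof (intro exI[of _ a] conjI allI impI ballI)
    fix k l assume "a k \<noteq> 0" "l \<notin> insert i S"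
    then show "k $ l = 0" using b0[of "k $ i" "upd k i 0" l] by (auto simp: a_def)
  next
    fix r M k assume "0 \<le> r" "r < \<rho>" "\<forall>\<theta>\<in>cstrip r. norm (F \<theta>) \<le> M"
    then show "norm (a k) \<le> M * exp (- 2 * pi * r * of_int (l1 k))" by (intro a_bound) auto
  next
    fix \<theta> :: "complex^'m" assume \<theta>: "\<theta> \<in> strip \<rho>"
    obtain s where s: "0 \<le> s" "s < \<rho>" "\<theta> \<in> cstrip s" using strip_imp_cstrip[OF \<theta>] by blast
    obtain r where r: "s < r" "r < \<rho>" using dense[OF s(2)] by blast
    obtain M where M: "\<And>\<theta>. \<theta> \<in> cstrip r \<Longrightarrow> norm (F \<theta>) \<le> M"
      using insert.prems(1) r s(1) unfolding separately_analytic_def by (metis le_less_trans less_imp_le)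
    let ?f = "\<lambda>k. a k * cexp (kdot k \<theta>)"
    let ?K = "{k::int^'m. k $ i = 0}"
    \<comment> \<open>Absolute summability of the joint family comes from the bound on
      \<open>a\<close> and is what permits replacing the iterated sum by the double sum.\<close>
    have "(\<lambda>k. norm (?f k)) summable_on UNIV"
      using r s by (intro fourier_summable[OF a_bound[OF _ r(2) M]]) auto
    then have sf: "?f summable_on UNIV" by (rule abs_summable_summable)
    have bij: "bij_betw (\<lambda>(j, k). upd k i j) (UNIV \<times> ?K) UNIV"
      by (rule bij_betwI[of _ _ _ "\<lambda>k. (k $ i, upd k i 0)"]) (auto simp: vec_eq_iff)
    have inner: "((\<lambda>k. ?f (upd k i j)) has_sum C j \<theta> * cexp (of_int j * \<theta> $ i)) ?K" for j
    proof -
      have "((\<lambda>k. b j k * cexp (kdot k \<theta>) * cexp (of_int j * \<theta> $ i)) has_sum C j \<theta> * cexp (of_int j * \<theta> $ i)) UNIV"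
        by (intro has_sum_cmult_left b2 \<theta>)
      also have "?this \<longleftrightarrow> ?thesis"
      proof (rule has_sum_cong_neutral)
        fix k assume "k \<in> UNIV - ?K"
        then show "b j k * cexp (kdot k \<theta>) * cexp (of_int j * \<theta> $ i) = 0"
          using b0[of j k i] insert.hyps by auto
      next
        fix k assume "k \<in> UNIV \<inter> ?K"
        then have k: "upd k i 0 = k" using upd_same[of k i] by simp
        show "b j k * cexp (kdot k \<theta>) * cexp (of_int j * \<theta> $ i) = ?f (upd k i j)"
          using kdot_upd[of "upd k i j" \<theta> i] by (simp add: a_def k cexp_add)
      qed auto
      finally show ?thesis .
    qed
    have outer: "((\<lambda>j. C j \<theta> * cexp (of_int j * \<theta> $ i)) has_sum F \<theta>) UNIV"
      using fourier_inversion[OF F1[OF \<theta>] nth_in_band[OF \<theta>, of i]] by (simp add: C_def sep_coeff_def)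
    have "((\<lambda>(j, k). ?f (upd k i j)) has_sum F \<theta>) (UNIV \<times> ?K)"
    proof (rule has_sum_SigmaI[where g = "\<lambda>j. C j \<theta> * cexp (of_int j * \<theta> $ i)"])
      show "((\<lambda>y. case (x, y) of (j, k) \<Rightarrow> ?f (upd k i j)) has_sum C x \<theta> * cexp (of_int x * \<theta> $ i)) ?K" for x
        using inner[of x] by simp
      show "(\<lambda>(j, k). ?f (upd k i j)) summable_on UNIV \<times> ?K"
        using summable_on_reindex_bij_betw[OF bij, of ?f] sf by (simp add: case_prod_unfold)
    qed (rule outer)
    then show "(?f has_sum F \<theta>) UNIV"
      using has_sum_reindex_bij_betw[OF bij, of ?f] by (simp add: case_prod_unfold)
  qed
qed

section \<open>Fourier series whose coefficients decay at every rate below the width of the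
  strip\<close>

definition fdecay :: "real \<Rightarrow> (int^'m \<Rightarrow> complex) \<Rightarrow> bool" where
  "fdecay \<rho> a \<longleftrightarrow> (\<forall>r. 0 \<le> r \<longrightarrow> r < \<rho> \<longrightarrow> (\<exists>M. \<forall>k. norm (a k) \<le> M * exp (- 2 * pi * r * of_int (l1 k))))"

definition fseries :: "(int^'m \<Rightarrow> complex) \<Rightarrow> complex^'m \<Rightarrow> complex" where
  "fseries a \<theta> = (\<Sum>\<^sub>\<infinity>k. a k * cexp (kdot k \<theta>))"

lemma fdecay_summable:
  fixes a :: "int^'m \<Rightarrow> complex"
  assumes a: "fdecay \<rho> a" and \<theta>: "\<theta> \<in> strip \<rho>"
  shows "(\<lambda>k. norm (a k * cexp (kdot k \<theta>))) summable_on UNIV"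
    "((\<lambda>k. a k * cexp (kdot k \<theta>)) has_sum fseries a \<theta>) UNIV"
proof -
  obtain s where s: "0 \<le> s" "s < \<rho>" "\<theta> \<in> cstrip s" using strip_imp_cstrip[OF \<theta>] by blast
  obtain r where r: "s < r" "r < \<rho>" using dense[OF s(2)] by blast
  have "0 \<le> r" using s r by simp
  then obtain M where M: "\<And>k. norm (a k) \<le> M * exp (- 2 * pi * r * of_int (l1 k))"
    using a r unfolding fdecay_def by blast
  show 1: "(\<lambda>k. norm (a k * cexp (kdot k \<theta>))) summable_on UNIV"
    by (rule fourier_summable[OF M s(3) r(1)])
  show "((\<lambda>k. a k * cexp (kdot k \<theta>)) has_sum fseries a \<theta>) UNIV"
    unfolding fseries_def by (rule has_sum_infsum[OF abs_summable_summable[OF 1]])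
qed

lemma multi_fourier:
  fixes F :: "complex^'m \<Rightarrow> complex"
  assumes "\<rho> > 0" "separately_analytic \<rho> F"
  shows "\<exists>a. fdecay \<rho> a \<and> (\<forall>\<theta>\<in>strip \<rho>. F \<theta> = fseries a \<theta>)"
proof -
  have dep: "F \<theta> = F \<phi>" if "\<And>i. i \<in> UNIV \<Longrightarrow> \<theta> $ i = \<phi> $ i" for \<theta> \<phi> :: "complex^'m"
  proof -
    have "\<theta> = \<phi>" using that by (simp add: vec_eq_iff)
    then show ?thesis by simp
  qed
  from multi_fourier_partial[OF finite assms dep] obtain a where a: "fourier_rep \<rho> UNIV F a"
    by blast
  have "fdecay \<rho> a"
    unfolding fdecay_def
  proof (intro allI impI)
    fix r assume r: "0 \<le> r" "r < \<rho>"
    then obtain M where "\<forall>\<theta>\<in>cstrip r. norm (F \<theta>) \<le> M"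
      using assms(2) unfolding separately_analytic_def by blast
    then show "\<exists>M. \<forall>k. norm (a k) \<le> M * exp (- 2 * pi * r * of_int (l1 k))"
      using a r unfolding fourier_rep_def by blast
  qed
  moreover have "F \<theta> = fseries a \<theta>" if "\<theta> \<in> strip \<rho>" for \<theta>
    using a that fdecay_summable(2)[OF \<open>fdecay \<rho> a\<close> that] has_sum_unique
    unfolding fourier_rep_def by blast
  ultimately show ?thesis by blast
qed

section \<open>Joint analyticity and its restriction to complex lines\<close>

lemma open_strip: "open (strip \<rho> :: (complex^'m) set)"
proof -
  have "strip \<rho> = (\<Inter>i. {\<theta> :: complex^'m. \<bar>Im (\<theta> $ i)\<bar> < \<rho>})" by (auto simp: strip_def)
  moreover have "open (\<Inter>i\<in>UNIV. {\<theta> :: complex^'m. \<bar>Im (\<theta> $ i)\<bar> < \<rho>})"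
    by (intro open_INT ballI open_Collect_less continuous_intros) auto
  ultimately show ?thesis by simp
qed

lemma mv_analyticD:
  assumes "mv_analytic_on F S" "z \<in> S"
  obtains D where "(F has_derivative D) (at z)" "\<And>c x. D (c *s x) = c * D x"
proof -
  obtain e where "e > 0" and e: "\<forall>w\<in>ball z e. \<exists>D. (F has_derivative D) (at w) \<and> (\<forall>c x. D (c *s x) = c * D x)"
    using assms unfolding mv_analytic_on_def by blast
  then have "z \<in> ball z e" by simp
  with e that show ?thesis by blast
qed

lemma mv_analyticI:
  assumes "open S"
    and D: "\<And>z. z \<in> S \<Longrightarrow> \<exists>D. (F has_derivative D) (at z) \<and> (\<forall>c x. D (c *s x) = c * D x)"
  shows "mv_analytic_on F S"
  unfolding mv_analytic_on_def
proof
  fix z assume "z \<in> S"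
  then obtain e where "e > 0" "ball z e \<subseteq> S" using openE[OF \<open>open S\<close>] by blast
  then show "\<exists>e>0. \<forall>w\<in>ball z e. \<exists>D. (F has_derivative D) (at w) \<and> (\<forall>c x. D (c *s x) = c * D x)"
    using D by (intro exI[of _ e]) auto
qed

lemma mv_analytic_on_subset: "mv_analytic_on F S \<Longrightarrow> T \<subseteq> S \<Longrightarrow> mv_analytic_on F T"
  unfolding mv_analytic_on_def by blast

lemma bounded_linear_scale: "bounded_linear (\<lambda>s::complex. s *s (b :: complex^'m))"
proof -
  have "linear (\<lambda>s::complex. s *s (b :: complex^'m))"
    by (rule linearI) (auto simp: vec_eq_iff algebra_simps)
  then show ?thesis by (simp add: linear_conv_bounded_linear)
qed

lemma line_derivative:
  fixes F :: "complex^'m \<Rightarrow> complex"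
  assumes D: "(F has_derivative D) (at (\<theta> + s *s b))" and lin: "\<And>c x. D (c *s x) = c * D x"
  shows "((\<lambda>s. F (\<theta> + s *s b)) has_field_derivative D b) (at s)"
proof -
  have "((\<lambda>s. \<theta> + s *s b) has_derivative (\<lambda>h. 0 + h *s b)) (at s)"
    by (intro has_derivative_add has_derivative_const bounded_linear_imp_has_derivative bounded_linear_scale)
  from diff_chain_at[OF this D] have "((\<lambda>s. F (\<theta> + s *s b)) has_derivative (\<lambda>h. D (h *s b))) (at s)"
    by (simp add: o_def)
  then show ?thesis unfolding has_field_derivative_def by (simp add: lin mult_commute_abs)
qed

lemma holomorphic_line:
  assumes F: "mv_analytic_on F S" and sub: "\<And>s. s \<in> A \<Longrightarrow> \<theta> + s *s b \<in> S"
  shows "(\<lambda>s. F (\<theta> + s *s b)) holomorphic_on A"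
  unfolding holomorphic_on_def
proof
  fix s assume "s \<in> A"
  then obtain D where "(F has_derivative D) (at (\<theta> + s *s b))" "\<And>c x. D (c *s x) = c * D x"
    using mv_analyticD[OF F sub] by blast
  from line_derivative[OF this] show "(\<lambda>s. F (\<theta> + s *s b)) field_differentiable at s within A"
    unfolding field_differentiable_def by (blast intro: has_field_derivative_at_within)
qed

lemma mv_analytic_continuous: "mv_analytic_on F S \<Longrightarrow> continuous_on S F"
  by (meson continuous_at_imp_continuous_on has_derivative_continuous mv_analyticD)

lemma strip_shift_real [simp]: "\<theta> + cvec x \<in> strip \<rho> \<longleftrightarrow> \<theta> \<in> strip \<rho>"
  by (auto simp: strip_def cvec_def)

text \<open>Holomorphy in one coordinate is restriction to a line. For the bounds, integer shifts
  bring a closed strip into a compact set, where continuity suffices.\<close>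

lemma analytic_imp_separately_analytic:
  fixes F :: "complex^'m \<Rightarrow> complex"
  assumes an: "mv_analytic_on F (strip \<rho>)" and per: "periodic_on (strip \<rho>) F"
  shows "separately_analytic \<rho> F"
  unfolding separately_analytic_def
proof (intro conjI ballI allI impI)
  fix \<theta> :: "complex^'m" and i assume \<theta>: "\<theta> \<in> strip \<rho>"
  have eq: "upd \<theta> i t = upd \<theta> i 0 + t *s axis i 1" for t
    by (auto simp: vec_eq_iff axis_def)
  have "(\<lambda>t. F (upd \<theta> i 0 + t *s axis i 1)) holomorphic_on band \<rho>"
    by (rule holomorphic_line[OF an]) (use upd_in_strip[OF \<theta>] eq in metis)
  then have hol: "(\<lambda>t. F (upd \<theta> i t)) holomorphic_on band \<rho>" by (simp flip: eq)
  have "upd \<theta> i (t + 1) = upd \<theta> i t + cvec (rvec (axis i 1))" for t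
    by (auto simp: vec_eq_iff axis_def cvec_def rvec_def)
  then have "F (upd \<theta> i (t + 1)) = F (upd \<theta> i t)" if "t \<in> band \<rho>" for t
    using per upd_in_strip[OF \<theta> that] unfolding periodic_on_def by simp
  with hol show "periodic_holo \<rho> (\<lambda>t. F (upd \<theta> i t))" unfolding periodic_holo_def by blast
next
  fix r assume r: "0 \<le> r" "r < \<rho>"
  \<comment> \<open>Assembles a complex vector from real and imaginary parts, so that the compact
    fundamental domain is the image of a product of two real boxes.\<close>
  define g where "g = (\<lambda>p :: (real^'m) \<times> (real^'m). (\<chi> i. of_real ((fst p :: real^'m) $ i) + \<i> * of_real ((snd p :: real^'m) $ i)) :: complex^'m)"
  let ?K = "g ` (cbox 0 1 \<times> cbox (\<chi> i. - r) (\<chi> i. r))"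
  have cK: "compact ?K"
    unfolding g_def by (intro compact_continuous_image compact_Times compact_cbox continuous_intros)
  have "?K \<subseteq> strip \<rho>"
  proof -
    have "\<bar>b $ i\<bar> < \<rho>" if "\<forall>i. - r \<le> b $ i \<and> b $ i \<le> r" for b :: "real^'m" and i
      using that[rule_format, of i] r by linarith
    then show ?thesis by (auto simp: g_def strip_def mem_box_cart)
  qed
  then have "continuous_on ?K F" using mv_analytic_continuous[OF an] continuous_on_subset by blast
  then have "bounded (F ` ?K)" by (rule compact_imp_bounded[OF compact_continuous_image[OF _ cK]])
  then obtain M where M: "\<And>\<theta>. \<theta> \<in> ?K \<Longrightarrow> norm (F \<theta>) \<le> M" unfolding bounded_iff by blast
  have "norm (F \<theta>) \<le> M" if \<theta>: "\<theta> \<in> cstrip r" for \<theta>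
  proof -
    define k :: "int^'m" where "k = (\<chi> i. - \<lfloor>Re (\<theta> $ i)\<rfloor>)"
    let ?\<phi> = "\<theta> + cvec (rvec k)"
    have eq: "?\<phi> = g ((\<chi> i. Re (?\<phi> $ i)), (\<chi> i. Im (?\<phi> $ i)))"
      by (simp add: g_def vec_eq_iff complex_eq_iff)
    have re: "Re (?\<phi> $ i) \<ge> 0 \<and> Re (?\<phi> $ i) \<le> 1" for i
      unfolding k_def cvec_def rvec_def by simp linarith
    have im: "- r \<le> Im (?\<phi> $ i) \<and> Im (?\<phi> $ i) \<le> r" for i
    proof -
      have "\<bar>Im (\<theta> $ i)\<bar> \<le> r" using \<theta> by (simp add: cstrip_def)
      then show ?thesis by (auto simp: cvec_def)
    qed
    have "?\<phi> \<in> ?K"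
    proof (rule image_eqI[where f = g, OF eq])
      show "((\<chi> i. Re (?\<phi> $ i)), (\<chi> i. Im (?\<phi> $ i))) \<in> cbox 0 1 \<times> cbox (\<chi> i. - r) (\<chi> i. r)"
        unfolding mem_Times_iff mem_box_cart fst_conv snd_conv vec_lambda_beta zero_index one_index
        using re im by blast
    qed
    moreover have "F ?\<phi> = F \<theta>"
      using per \<theta> cstrip_subset_strip[OF r(2)] unfolding periodic_on_def by blast
    ultimately show ?thesis using M by metis
  qed
  then show "\<exists>M. \<forall>\<theta>\<in>cstrip r. norm (F \<theta>) \<le> M" by blast
qed

section \<open>Subexponential multipliers and termwise differentiation\<close>

definition subexp :: "(int^'m \<Rightarrow> complex) \<Rightarrow> bool" where
  "subexp c \<longleftrightarrow> (\<forall>\<epsilon>>0. \<exists>C. \<forall>k. norm (c k) \<le> C * exp (\<epsilon> * of_int (l1 k)))"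

text \<open>For a target rate r, start from the decay at some s between r and \<rho>; the growth of
  \<open>c\<close> is paid out of the gap s - r. The width \<rho> is preserved.\<close>

lemma fdecay_subexp:
  fixes a :: "int^'m \<Rightarrow> complex"
  assumes a: "fdecay \<rho> a" and c: "subexp c"
  shows "fdecay \<rho> (\<lambda>k. c k * a k)"
  unfolding fdecay_def
proof (intro allI impI)
  fix r assume r: "0 \<le> r" "r < \<rho>"
  obtain s where s: "r < s" "s < \<rho>" using dense[OF r(2)] by blast
  have "0 \<le> s" using r s by simp
  then obtain M where M: "\<And>k. norm (a k) \<le> M * exp (- 2 * pi * s * of_int (l1 k))"
    using a s unfolding fdecay_def by blast
  have "2 * pi * (s - r) > 0" using s by simp
  then obtain C where C: "\<And>k. norm (c k) \<le> C * exp (2 * pi * (s - r) * of_int (l1 k))"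
    using c unfolding subexp_def by blast
  show "\<exists>M. \<forall>k. norm (c k * a k) \<le> M * exp (- 2 * pi * r * of_int (l1 k))"
  proof (intro exI allI)
    fix k
    have "norm (c k * a k) \<le> (C * exp (2 * pi * (s - r) * of_int (l1 k))) * (M * exp (- 2 * pi * s * of_int (l1 k)))"
      unfolding norm_mult by (intro mult_mono C M order_trans[OF norm_ge_zero C]) auto
    also have "\<dots> = C * M * exp (- 2 * pi * r * of_int (l1 k))"
      by (simp add: exp_add[symmetric] algebra_simps)
    finally show "norm (c k * a k) \<le> C * M * exp (- 2 * pi * r * of_int (l1 k))" .
  qed
qed

lemma norm_kdot_le: "norm (kdot k h) \<le> of_int (l1 k) * norm h"
proof -
  have "norm (kdot k h) \<le> (\<Sum>i\<in>UNIV. of_int \<bar>k $ i\<bar> * norm h)"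
    unfolding kdot_def by (intro sum_norm_le) (auto simp: norm_mult intro!: mult_left_mono Finite_Cartesian_Product.norm_nth_le)
  also have "\<dots> = of_int (l1 k) * norm h" by (simp add: l1_def sum_distrib_right)
  finally show ?thesis .
qed

lemma subexp_kdot: "subexp (\<lambda>k. kdot k h)"
  unfolding subexp_def
proof (intro allI impI)
  fix \<epsilon> :: real assume \<epsilon>: "\<epsilon> > 0"
  show "\<exists>C. \<forall>k. norm (kdot k h) \<le> C * exp (\<epsilon> * of_int (l1 k))"
  proof (intro exI allI)
    fix k :: "int^'a"
    \<comment> \<open>Linear growth is subexponential because t < exp t; with t = \<epsilon> |k|
      this gives the constant norm h / \<epsilon>.\<close>
    have "\<epsilon> * of_int (l1 k) \<le> exp (\<epsilon> * of_int (l1 k))"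
      using exp_ge_add_one_self[of "\<epsilon> * of_int (l1 k)"] by linarith
    then have "\<epsilon> * of_int (l1 k) * (norm h / \<epsilon>) \<le> exp (\<epsilon> * of_int (l1 k)) * (norm h / \<epsilon>)"
      using \<epsilon> by (intro mult_right_mono) auto
    then show "norm (kdot k h) \<le> (norm h / \<epsilon>) * exp (\<epsilon> * of_int (l1 k))"
      using norm_kdot_le[of k h] \<epsilon> by (simp add: mult.commute)
  qed
qed

lemma subexp_cmult: "subexp c \<Longrightarrow> subexp (\<lambda>k. z * c k)"
  unfolding subexp_def
proof (intro allI impI)
  fix \<epsilon> :: real assume c: "\<forall>\<epsilon>>0. \<exists>C. \<forall>k. norm (c k) \<le> C * exp (\<epsilon> * of_int (l1 k))" and "\<epsilon> > 0"
  then obtain C where "\<And>k. norm (c k) \<le> C * exp (\<epsilon> * of_int (l1 k))" by blast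
  then have "norm z * norm (c k) \<le> norm z * (C * exp (\<epsilon> * of_int (l1 k)))" for k
    by (intro mult_left_mono) auto
  then show "\<exists>C. \<forall>k. norm (z * c k) \<le> C * exp (\<epsilon> * of_int (l1 k))"
    by (intro exI[of _ "norm z * C"]) (simp add: norm_mult mult.assoc)
qed

text \<open>The coefficients of the derivative of \<open>fseries a\<close> in direction
  \<open>h\<close>, as termwise differentiation predicts.\<close>

definition dir_coeff :: "(int^'m \<Rightarrow> complex) \<Rightarrow> complex^'m \<Rightarrow> int^'m \<Rightarrow> complex" where
  "dir_coeff a h k = 2 * of_real pi * \<i> * kdot k h * a k"

lemma fdecay_dir_coeff: "fdecay \<rho> a \<Longrightarrow> fdecay \<rho> (dir_coeff a h)"
  unfolding dir_coeff_def[abs_def] by (intro fdecay_subexp subexp_cmult subexp_kdot)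

text \<open>The first-order Taylor remainder of each term is at most |h|^2 times a summable
  \<open>f k\<close> independent of \<open>h\<close>, so the remainder of the whole series is
  quadratic in \<open>h\<close>.\<close>

lemma fseries_derivative:
  fixes a :: "int^'m \<Rightarrow> complex"
  assumes a: "fdecay \<rho> a" and \<theta>: "\<theta> \<in> strip \<rho>"
  shows "(fseries a has_derivative (\<lambda>h. fseries (dir_coeff a h) \<theta>)) (at \<theta>)"
    "fseries (dir_coeff a (c *s h)) \<theta> = c * fseries (dir_coeff a h) \<theta>"
proof -
  have scale: "fseries (dir_coeff a (c *s h)) \<theta> = c * fseries (dir_coeff a h) \<theta>" for c h
    unfolding fseries_def infsum_cmult_right'[symmetric]
    by (intro infsum_cong) (simp add: dir_coeff_def kdot_scale)
  then show "fseries (dir_coeff a (c *s h)) \<theta> = c * fseries (dir_coeff a h) \<theta>" .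
  have hs: "((\<lambda>k. dir_coeff a h k * cexp (kdot k \<theta>)) has_sum fseries (dir_coeff a h) \<theta>) UNIV" for h
    by (rule fdecay_summable(2)[OF fdecay_dir_coeff[OF a] \<theta>])
  have "linear (\<lambda>h. fseries (dir_coeff a h) \<theta>)"
  proof (rule linearI)
    fix h g
    have "((\<lambda>k. dir_coeff a h k * cexp (kdot k \<theta>) + dir_coeff a g k * cexp (kdot k \<theta>)) has_sum
        fseries (dir_coeff a h) \<theta> + fseries (dir_coeff a g) \<theta>) UNIV"
      by (intro has_sum_add hs)
    moreover have "dir_coeff a h k * cexp (kdot k \<theta>) + dir_coeff a g k * cexp (kdot k \<theta>) = dir_coeff a (h + g) k * cexp (kdot k \<theta>)" for k
      by (simp add: dir_coeff_def kdot_add algebra_simps)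
    ultimately show "fseries (dir_coeff a (h + g)) \<theta> = fseries (dir_coeff a h) \<theta> + fseries (dir_coeff a g) \<theta>"
      using has_sum_unique[OF hs[of "h + g"]] by simp
  next
    fix r :: real and h :: "complex^'m"
    have "r *\<^sub>R h = of_real r *s h" by (simp add: vec_eq_iff) (simp add: scaleR_conv_of_real)
    then show "fseries (dir_coeff a (r *\<^sub>R h)) \<theta> = r *\<^sub>R fseries (dir_coeff a h) \<theta>"
      by (simp add: scale scaleR_conv_of_real)
  qed
  then have bl: "bounded_linear (\<lambda>h. fseries (dir_coeff a h) \<theta>)" by (simp add: linear_conv_bounded_linear)
  obtain s where s: "0 \<le> s" "s < \<rho>" "\<theta> \<in> cstrip s" using strip_imp_cstrip[OF \<theta>] by blast
  obtain r where r: "s < r" "r < \<rho>" using dense[OF s(2)] by blast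
  have "0 \<le> r" using s r by simp
  then obtain M where M: "\<And>k. norm (a k) \<le> M * exp (- 2 * pi * r * of_int (l1 k))"
    using a r unfolding fdecay_def by blast
  have M0: "M \<ge> 0" using order_trans[OF norm_ge_zero M[of 0]] by (simp add: l1_def)
  \<comment> \<open>The gap r - s between decay and growth is cut into four. One quarter covers exp
    (norm u), one absorbs the factor |k|^2, and the remaining two give the summable exp (- 4 pi
    \<epsilon> |k|).\<close>
  define \<epsilon> where "\<epsilon> = (r - s) / 4"
  have \<epsilon>: "\<epsilon> > 0" "s + \<epsilon> < \<rho>" using r by (auto simp: \<epsilon>_def field_simps)
  define f where "f = (\<lambda>k :: int^'m. 2 * M / \<epsilon>^2 * exp (- (4 * pi * \<epsilon>) * of_int (l1 k)))"
  have "f summable_on UNIV"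
    unfolding f_def using \<epsilon> by (intro summable_on_cmult_right summable_on_exp_l1) auto
  then have f: "(f has_sum infsum f UNIV) UNIV" by simp
  have rem: "norm (fseries a y - fseries a \<theta> - fseries (dir_coeff a (y - \<theta>)) \<theta>) / norm (y - \<theta>)
      \<le> norm (y - \<theta>) * infsum f UNIV" if y: "y \<noteq> \<theta>" "dist y \<theta> < \<epsilon>" for y
  proof -
    define h where "h = y - \<theta>"
    have h: "norm h < \<epsilon>" "norm h > 0" "y = \<theta> + h" using y by (auto simp: h_def dist_norm)
    have "y \<in> strip \<rho>"
      unfolding strip_def
    proof safe
      fix i
      have "\<bar>Im (h $ i)\<bar> \<le> norm h"
        using abs_Im_le_cmod Finite_Cartesian_Product.norm_nth_le order_trans by blast
      moreover have "\<bar>Im (\<theta> $ i)\<bar> \<le> s" using s by (simp add: cstrip_def)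
      ultimately show "\<bar>Im (y $ i)\<bar> < \<rho>" using h \<epsilon> by simp
    qed
    have "((\<lambda>k. a k * cexp (kdot k y) + - (a k * cexp (kdot k \<theta>)) + - (dir_coeff a h k * cexp (kdot k \<theta>))) has_sum
        fseries a y + - fseries a \<theta> + - fseries (dir_coeff a h) \<theta>) UNIV"
      by (intro has_sum_add has_sum_uminusI hs fdecay_summable(2)[OF a] \<theta> \<open>y \<in> strip \<rho>\<close>)
    moreover have "((\<lambda>k. norm h ^ 2 * f k) has_sum norm h ^ 2 * infsum f UNIV) UNIV"
      by (intro has_sum_cmult_right f)
    ultimately have "norm (fseries a y + - fseries a \<theta> + - fseries (dir_coeff a h) \<theta>) \<le> norm h ^ 2 * infsum f UNIV"
    proof (rule norm_infsum_le)
      fix k :: "int^'m"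
      define l where "l = real_of_int (l1 k)"
      have l0: "l \<ge> 0" by (simp add: l_def l1_nonneg)
      define u where "u = 2 * of_real pi * \<i> * kdot k h"
      have u: "norm u \<le> 2 * pi * l * norm h"
        using norm_kdot_le[of k h] by (simp add: u_def norm_mult l_def)
      have "norm (cexp (kdot k h) - (1 + u)) \<le> exp (norm u) * norm u ^ 2"
        using Taylor_exp_field[of u 1] by (simp add: cexp_def u_def power2_eq_square)
      also have "\<dots> \<le> exp (2 * pi * l * \<epsilon>) * (2 * pi * l * norm h) ^ 2"
      proof (intro mult_mono power_mono u)
        have "2 * pi * l * norm h \<le> 2 * pi * l * \<epsilon>" using h l0 by (intro mult_left_mono) auto
        from order_trans[OF u this] show "exp (norm u) \<le> exp (2 * pi * l * \<epsilon>)" by simp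
      qed auto
      also have "\<dots> \<le> exp (2 * pi * l * \<epsilon>) * (2 / \<epsilon>^2 * exp (2 * pi * l * \<epsilon>) * norm h ^ 2)"
      proof (intro mult_left_mono)
        \<comment> \<open>x^2 < 2 exp x for x >= 0 trades the quadratic factor in the frequency for
          an exponential, at the price 1 / \<epsilon>^2.\<close>
        have "(2 * pi * l * \<epsilon>)^2 \<le> 2 * exp (2 * pi * l * \<epsilon>)"
          using exp_lower_Taylor_quadratic[of "2 * pi * l * \<epsilon>"] l0 \<epsilon> by (simp add: power2_eq_square) (smt (verit) mult_nonneg_nonneg pi_ge_zero)
        then have "(2 * pi * l * \<epsilon>)^2 * (norm h ^ 2 / \<epsilon>^2) \<le> 2 * exp (2 * pi * l * \<epsilon>) * (norm h ^ 2 / \<epsilon>^2)"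
          by (intro mult_right_mono) auto
        then show "(2 * pi * l * norm h) ^ 2 \<le> 2 / \<epsilon>^2 * exp (2 * pi * l * \<epsilon>) * norm h ^ 2"
          using \<epsilon> by (simp add: power_mult_distrib)
      qed auto
      finally have E: "norm (cexp (kdot k h) - (1 + u)) \<le> exp (2 * pi * l * \<epsilon>) * (2 / \<epsilon>^2 * exp (2 * pi * l * \<epsilon>) * norm h ^ 2)" .
      have "a k * cexp (kdot k y) + - (a k * cexp (kdot k \<theta>)) + - (dir_coeff a h k * cexp (kdot k \<theta>)) =
          a k * cexp (kdot k \<theta>) * (cexp (kdot k h) - (1 + u))"
        by (simp add: h(3) kdot_add cexp_add dir_coeff_def u_def algebra_simps)
      also have "norm \<dots> \<le> (M * exp (- 2 * pi * r * l)) * exp (2 * pi * s * l) *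
          (exp (2 * pi * l * \<epsilon>) * (2 / \<epsilon>^2 * exp (2 * pi * l * \<epsilon>) * norm h ^ 2))"
        unfolding norm_mult using M0 M[of k] norm_cexp_kdot[OF s(3), of k] E by (intro mult_mono) (auto simp: l_def)
      also have "\<dots> = norm h ^ 2 * (2 * M / \<epsilon>^2 * (exp (- 2 * pi * r * l) * exp (2 * pi * s * l) * exp (2 * pi * l * \<epsilon>) * exp (2 * pi * l * \<epsilon>)))"
        by simp
      also have "exp (- 2 * pi * r * l) * exp (2 * pi * s * l) * exp (2 * pi * l * \<epsilon>) * exp (2 * pi * l * \<epsilon>) = exp (- (4 * pi * \<epsilon>) * l)"
        unfolding exp_add[symmetric] by (simp add: \<epsilon>_def field_simps)
      finally show "norm (a k * cexp (kdot k y) + - (a k * cexp (kdot k \<theta>)) + - (dir_coeff a h k * cexp (kdot k \<theta>))) \<le> norm h ^ 2 * f k"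
        unfolding f_def l_def .
    qed
    then show ?thesis
      using h by (simp add: h_def[symmetric] divide_le_eq power2_eq_square mult_ac)
  qed
  show "(fseries a has_derivative (\<lambda>h. fseries (dir_coeff a h) \<theta>)) (at \<theta>)"
  proof (rule has_derivativeI_sandwich[OF \<epsilon>(1) bl])
    show "norm (fseries a y - fseries a \<theta> - fseries (dir_coeff a (y - \<theta>)) \<theta>) / norm (y - \<theta>)
      \<le> norm (y - \<theta>) * infsum f UNIV" if "y \<noteq> \<theta>" "dist y \<theta> < \<epsilon>" for y using rem[OF that] .
    have "((\<lambda>y. norm (y - \<theta>) * infsum f UNIV) \<longlongrightarrow> norm (\<theta> - \<theta>) * infsum f UNIV) (at \<theta>)"
      by (intro tendsto_intros)
    then show "((\<lambda>y. norm (y - \<theta>) * infsum f UNIV) \<longlongrightarrow> 0) (at \<theta>)" by simp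
  qed
qed

lemma fseries_analytic: "fdecay \<rho> a \<Longrightarrow> mv_analytic_on (fseries a) (strip \<rho>)"
  by (rule mv_analyticI[OF open_strip]) (use fseries_derivative in blast)

lemma fseries_periodic: "fseries a (\<theta> + cvec (rvec k)) = fseries a \<theta>"
proof -
  have "kdot j (cvec (rvec k)) = of_int (\<Sum>i\<in>UNIV. j $ i * k $ i)" for j
    by (simp add: kdot_def cvec_def rvec_def)
  then have "cexp (kdot j (\<theta> + cvec (rvec k))) = cexp (kdot j \<theta>)" for j
    by (simp only: kdot_add cexp_add cexp_of_int mult_1_right)
  then show ?thesis by (simp add: fseries_def)
qed

section \<open>Small divisors\<close>

text \<open>For t = pi |y|, the mean value theorem with cos >= 1/2 works up to pi / 3; beyond that
  sin t >= 1/2 while t <= 2. The constant is just good enough for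
  \<open>cos_infdist_bound\<close>.\<close>

lemma sin_lower_bound:
  assumes "\<bar>y\<bar> \<le> 1 / 2"
  shows "\<bar>y\<bar> / 2 \<le> \<bar>sin (pi * y)\<bar>"
proof -
  have pos: "t / 4 \<le> sin t" if t: "0 \<le> t" "t \<le> pi / 2" for t :: real
  proof (cases "t \<le> pi / 3")
    case True
    show ?thesis
    proof (cases "t = 0")
      case False
      then obtain z where z: "0 < z" "z < t" "sin t - sin 0 = (t - 0) * cos z"
        using MVT2[of 0 t sin cos] t by auto
      have "cos (pi / 3) \<le> cos z" using z True by (intro cos_monotone_0_pi_le) auto
      then have "t * (1 / 2) \<le> t * cos z" using t by (intro mult_left_mono) (auto simp: cos_60)
      then show ?thesis using z t by simp
    qed simp
  next
    case False
    have "sin (pi / 6) \<le> sin t" using False t by (intro sin_monotone_2pi_le) auto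
    moreover have "t \<le> 2" using t pi_half_less_two by simp
    ultimately show ?thesis by (simp add: sin_30)
  qed
  have "\<bar>y\<bar> / 2 \<le> pi * \<bar>y\<bar> / 4"
    using mult_right_mono[of 2 pi "\<bar>y\<bar>"] pi_ge_two by simp
  also have "\<dots> \<le> sin (pi * \<bar>y\<bar>)"
    using pos[of "pi * \<bar>y\<bar>"] assms by simp
  also have "\<dots> \<le> \<bar>sin (pi * y)\<bar>" by (auto simp: abs_if)
  finally show ?thesis .
qed

text \<open>2 - 2 cos (2 pi x) = (2 sin (pi x))^2, and by periodicity x may be replaced by its
  offset from the nearest integer. The square makes the loss in the divisors twice that of the
  distances.\<close>

lemma cos_infdist_bound: "(infdist x \<int>)\<^sup>2 \<le> 2 - 2 * cos (2 * pi * x)"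
proof -
  define n where "n = round x"
  define y where "y = x - of_int n"
  have y: "\<bar>y\<bar> \<le> 1 / 2" using of_int_round_abs_le[of x] by (simp add: y_def n_def abs_minus_commute)
  have "infdist x \<int> \<le> dist x (of_int n)" by (intro infdist_le) auto
  then have d: "infdist x \<int> \<le> \<bar>y\<bar>" by (simp add: y_def dist_real_def)
  have "cos (2 * pi * x) = cos (2 * pi * y + 2 * pi * of_int n)"
    by (simp add: y_def algebra_simps)
  also have "\<dots> = cos (2 * pi * y)" by (simp add: cos_add)
  also have "2 * pi * y = 2 * (pi * y)" by simp
  also have "cos (2 * (pi * y)) = 1 - 2 * (sin (pi * y))\<^sup>2" by (rule cos_double_sin)
  finally have c: "2 - 2 * cos (2 * pi * x) = (2 * \<bar>sin (pi * y)\<bar>)\<^sup>2" by (simp add: power_mult_distrib)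
  have "(infdist x \<int>)\<^sup>2 \<le> (2 * \<bar>sin (pi * y)\<bar>)\<^sup>2"
    using d sin_lower_bound[OF y] by (intro power_mono infdist_nonneg) simp
  then show ?thesis by (simp add: c)
qed

lemma divisor_lower_bound:
  fixes \<Omega> :: "real^'n"
  assumes dioph: "subexponential_divisors \<Omega>" and \<epsilon>: "\<epsilon> > 0"
  obtains C where "C > 0" "\<And>k :: int^'n. 0 < l1 k \<Longrightarrow> C * exp (- \<epsilon> * of_int (l1 k)) \<le> infdist (rvec k \<bullet> \<Omega>) \<int>"
proof -
  let ?d = "\<lambda>k :: int^'n. infdist (rvec k \<bullet> \<Omega>) \<int>"
  let ?S = "\<lambda>N::nat. SUP k \<in> {k :: int^'n. 0 < l1 k \<and> l1 k \<le> int N}. abs_ln (?d k)"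
  have "((\<lambda>N. ereal (1 / real N) * ?S N) \<longlongrightarrow> 0) sequentially"
    using dioph unfolding subexponential_divisors_def .
  then have "eventually (\<lambda>N. ereal (1 / real N) * ?S N < ereal \<epsilon>) sequentially"
    using \<epsilon> by (intro order_tendstoD) auto
  then obtain N0 where N0: "\<And>N. N \<ge> N0 \<Longrightarrow> ereal (1 / real N) * ?S N < ereal \<epsilon>"
    unfolding eventually_sequentially by blast
  show ?thesis
  proof (rule that)
    show "exp (- \<epsilon> * real N0) > 0" by simp
    fix k :: "int^'n" assume k: "0 < l1 k"
    \<comment> \<open>Large enough both for the limit statement and to include \<open>k\<close> in
      the supremum; exceeding |k| by \<open>N0\<close> costs only the constant factor exp (-
      \<epsilon> N0).\<close>
    define N where "N = N0 + nat (l1 k)"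
    have N: "N \<ge> N0" "0 < N" "l1 k \<le> int N" using k by (auto simp: N_def)
    have "abs_ln (?d k) \<le> ?S N" using k N by (intro SUP_upper) auto
    then have "ereal (1 / real N) * abs_ln (?d k) \<le> ereal (1 / real N) * ?S N"
      by (intro ereal_mult_left_mono) auto
    also have "\<dots> < ereal \<epsilon>" by (rule N0[OF N(1)])
    finally have lt: "ereal (1 / real N) * abs_ln (?d k) < ereal \<epsilon>" .
    \<comment> \<open>Here the convention that \<open>abs_ln 0\<close> is infinite enters: a
      vanishing distance would violate the finite bound.\<close>
    have nz: "?d k \<noteq> 0"
    proof
      assume "?d k = 0"
      then show False using lt N by (simp add: abs_ln_def)
    qed
    then have dpos: "?d k > 0" using infdist_nonneg[of "rvec k \<bullet> \<Omega>" \<int>] by simp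
    have "\<bar>ln (?d k)\<bar> / real N < \<epsilon>" using lt nz by (simp add: abs_ln_def)
    then have "\<bar>ln (?d k)\<bar> < \<epsilon> * real N" using N by (simp add: divide_less_eq)
    then have "- (\<epsilon> * real N) \<le> ln (?d k)" by simp
    then have "exp (- (\<epsilon> * real N)) \<le> ?d k" using dpos by (metis exp_le_cancel_iff exp_ln)
    moreover have "exp (- (\<epsilon> * real N)) = exp (- \<epsilon> * real N0) * exp (- \<epsilon> * of_int (l1 k))"
      using k by (simp add: N_def exp_add[symmetric] algebra_simps)
    ultimately show "exp (- \<epsilon> * real N0) * exp (- \<epsilon> * of_int (l1 k)) \<le> ?d k" by simp
  qed
qed

section \<open>The multiplier that inverts the second difference\<close>

definition some_part :: "int^('n option) \<Rightarrow> int^'n" where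
  "some_part k = (\<chi> j. k $ Some j)"

lemma sum_option: "(\<Sum>i\<in>UNIV. f i) = f None + (\<Sum>j\<in>(UNIV::'n::finite set). f (Some j))"
  by (simp add: UNIV_option_conv sum.reindex)

lemma l1_some_part: "l1 (some_part k) \<le> l1 k"
  by (simp add: l1_def sum_option some_part_def)

lemma kdot_join: "kdot k (join \<psi> \<eta>) = of_int (k $ None) * \<eta> + kdot (some_part k) \<psi>"
  by (simp add: kdot_def sum_option join_def some_part_def)

lemma kdot_0 [simp]: "kdot 0 \<theta> = 0"
  by (simp add: kdot_def)

lemma kdot_cvec: "kdot k (cvec x) = of_real (rvec k \<bullet> x)"
  by (simp add: kdot_def cvec_def rvec_def inner_vec_def)

lemma l1_pos: "k \<noteq> 0 \<Longrightarrow> 0 < l1 k"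
proof -
  assume "k \<noteq> 0"
  then obtain i where "k $ i \<noteq> 0" by (auto simp: vec_eq_iff)
  then have "0 < \<bar>k $ i\<bar>" by simp
  also have "\<dots> \<le> l1 k" unfolding l1_def by (rule member_le_sum) auto
  finally show ?thesis .
qed

text \<open>On the character with frequency \<open>k\<close> the second difference along \<Omega>
  acts as minus this divisor. The value 0 for frequencies with zero \<psi> part fixes the freedom of
  adding a function of \<eta>: the solution has average 0 over \<psi>.\<close>

definition inv_divisor :: "real^'n \<Rightarrow> int^('n option) \<Rightarrow> complex" where
  "inv_divisor \<Omega> k = (if some_part k = 0 then 0
     else of_real (inverse (2 - 2 * cos (2 * pi * (rvec (some_part k) \<bullet> \<Omega>)))))"

lemma subexp_inv_divisor:
  assumes dioph: "subexponential_divisors \<Omega>"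
  shows "subexp (inv_divisor \<Omega>)"
  unfolding subexp_def
proof (intro allI impI)
  fix \<epsilon> :: real assume "\<epsilon> > 0"
  \<comment> \<open>Half of \<epsilon>, because the divisor is bounded below by the square of the
    distance.\<close>
  then obtain C where C: "C > 0"
    "\<And>k. 0 < l1 k \<Longrightarrow> C * exp (- (\<epsilon> / 2) * of_int (l1 k)) \<le> infdist (rvec k \<bullet> \<Omega>) \<int>"
    using divisor_lower_bound[OF dioph, of "\<epsilon> / 2"] by auto
  show "\<exists>C. \<forall>k. norm (inv_divisor \<Omega> k) \<le> C * exp (\<epsilon> * of_int (l1 k))"
  proof (intro exI allI)
    fix k :: "int^('a option)"
    show "norm (inv_divisor \<Omega> k) \<le> inverse (C\<^sup>2) * exp (\<epsilon> * of_int (l1 k))"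
    proof (cases "some_part k = 0")
      case False
      let ?l = "real_of_int (l1 (some_part k))"
      let ?D = "2 - 2 * cos (2 * pi * (rvec (some_part k) \<bullet> \<Omega>))"
      have "C\<^sup>2 * exp (- \<epsilon> * ?l) = (C * exp (- (\<epsilon> / 2) * ?l))\<^sup>2"
        by (simp add: power_mult_distrib exp_double[symmetric])
      also have "\<dots> \<le> (infdist (rvec (some_part k) \<bullet> \<Omega>) \<int>)\<^sup>2"
        using C(1) by (intro power_mono C(2) l1_pos False) auto
      also have "\<dots> \<le> ?D" by (rule cos_infdist_bound)
      finally have D: "C\<^sup>2 * exp (- \<epsilon> * ?l) \<le> ?D" .
      have pos: "0 < C\<^sup>2 * exp (- \<epsilon> * ?l)" using C(1) by simp
      have "norm (inv_divisor \<Omega> k) = inverse ?D"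
        using False D pos by (simp add: inv_divisor_def norm_inverse del: of_real_inverse of_real_diff of_real_mult)
      also have "\<dots> \<le> inverse (C\<^sup>2 * exp (- \<epsilon> * ?l))" by (rule le_imp_inverse_le[OF D pos])
      also have "\<dots> = inverse (C\<^sup>2) * exp (\<epsilon> * ?l)" by (simp add: exp_minus)
      also have "\<dots> \<le> inverse (C\<^sup>2) * exp (\<epsilon> * of_int (l1 k))"
        using \<open>\<epsilon> > 0\<close> l1_some_part[of k] by (intro mult_left_mono) auto
      finally show ?thesis .
    qed (simp add: inv_divisor_def)
  qed
qed

section \<open>Reflection symmetry and reality\<close>

definition vcnj :: "complex^'m \<Rightarrow> complex^'m" where
  "vcnj \<theta> = (\<chi> i. cnj (\<theta> $ i))"

lemma vcnj_vcnj [simp]: "vcnj (vcnj \<theta>) = \<theta>"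
  by (simp add: vcnj_def vec_eq_iff)

lemma vcnj_cvec [simp]: "vcnj (cvec x) = cvec x"
  by (simp add: vcnj_def cvec_def vec_eq_iff)

lemma vcnj_in_strip [simp]: "vcnj \<theta> \<in> strip \<rho> \<longleftrightarrow> \<theta> \<in> strip \<rho>"
  by (simp add: vcnj_def strip_def)

lemma cnj_kdot: "cnj (kdot k \<theta>) = kdot k (vcnj \<theta>)"
  by (simp add: kdot_def vcnj_def)

text \<open>The coefficients of the reflected function that sends \<theta> to the conjugate of the
  value at \<open>vcnj \<theta>\<close>; for a real direction, differentiation commutes with this
  operation.\<close>

definition conj_coeff :: "(int^'m \<Rightarrow> complex) \<Rightarrow> int^'m \<Rightarrow> complex" where
  "conj_coeff a k = cnj (a (- k))"

lemma cnj_fseries: "cnj (fseries a \<theta>) = fseries (conj_coeff a) (vcnj \<theta>)"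
proof -
  have "cnj (fseries a \<theta>) = (\<Sum>\<^sub>\<infinity>k. cnj (a k * cexp (kdot k \<theta>)))"
    unfolding fseries_def by (rule infsum_cnj[symmetric])
  also have "\<dots> = fseries (conj_coeff a) (vcnj \<theta>)"
    unfolding fseries_def
    by (rule infsum_reindex_bij_witness[of UNIV uminus uminus])
      (auto simp: conj_coeff_def cnj_cexp cnj_kdot kdot_minus)
  finally show ?thesis .
qed

lemma fdecay_conj_coeff: "fdecay \<rho> a \<Longrightarrow> fdecay \<rho> (conj_coeff a)"
  unfolding fdecay_def conj_coeff_def by (metis complex_mod_cnj l1_minus)

text \<open>
  The flag \<open>b\<close> switches on the reflection symmetry that expresses reality on real arguments and,
  unlike the latter, makes sense coefficientwise on the Fourier side.
\<close>

definition torus_analytic :: "bool \<Rightarrow> real \<Rightarrow> (complex^'m \<Rightarrow> complex) \<Rightarrow> bool" where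
  "torus_analytic b \<rho> F \<longleftrightarrow> mv_analytic_on F (strip \<rho>) \<and> periodic_on (strip \<rho>) F \<and>
     (b \<longrightarrow> (\<forall>\<theta>\<in>strip \<rho>. F (vcnj \<theta>) = cnj (F \<theta>)))"

lemma torus_analytic_fseries:
  assumes "fdecay \<rho> a" "b \<Longrightarrow> conj_coeff a = a"
  shows "torus_analytic b \<rho> (fseries a)"
  using assms fseries_analytic[of \<rho> a] cnj_fseries[of a]
  by (auto simp: torus_analytic_def periodic_on_def fseries_periodic)

lemma fdecay_add:
  assumes "fdecay \<rho> a" "fdecay \<rho> c"
  shows "fdecay \<rho> (\<lambda>k. a k + c k)"
  unfolding fdecay_def
proof (intro allI impI)
  fix r assume r: "0 \<le> r" "r < \<rho>"
  obtain M N where "\<And>k. norm (a k) \<le> M * exp (- 2 * pi * r * of_int (l1 k))"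
     "\<And>k. norm (c k) \<le> N * exp (- 2 * pi * r * of_int (l1 k))"
    using assms r unfolding fdecay_def by blast
  then have "norm (a k + c k) \<le> (M + N) * exp (- 2 * pi * r * of_int (l1 k))" for k
    unfolding distrib_right by (rule norm_triangle_mono)
  then show "\<exists>M. \<forall>k. norm (a k + c k) \<le> M * exp (- 2 * pi * r * of_int (l1 k))" by blast
qed

lemma subexp_bounded:
  assumes "\<And>k. norm (c k) \<le> 1"
  shows "subexp c"
  unfolding subexp_def
proof (intro allI impI exI)
  fix \<epsilon> :: real and k :: "int^'a" assume "\<epsilon> > 0"
  then have "1 \<le> 1 * exp (\<epsilon> * of_int (l1 k))" by (simp add: l1_nonneg)
  with assms show "norm (c k) \<le> 1 * exp (\<epsilon> * of_int (l1 k))" by (rule order_trans)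
qed

text \<open>The symmetry of the coefficients is enforced instead of being deduced from their
  uniqueness: a symmetric \<open>F\<close> is represented both by \<open>a\<close> and by its
  reflection, hence also by their average, which is symmetric.\<close>

lemma torus_analytic_fourier:
  fixes F :: "complex^'m \<Rightarrow> complex"
  assumes \<rho>: "\<rho> > 0" and F: "torus_analytic b \<rho> F"
  obtains a where "fdecay \<rho> a" "\<And>\<theta>. \<theta> \<in> strip \<rho> \<Longrightarrow> F \<theta> = fseries a \<theta>" "b \<Longrightarrow> conj_coeff a = a"
proof -
  have "separately_analytic \<rho> F" using F analytic_imp_separately_analytic unfolding torus_analytic_def by blast
  from multi_fourier[OF \<rho> this] obtain a where
    a: "fdecay \<rho> a" "\<And>\<theta>. \<theta> \<in> strip \<rho> \<Longrightarrow> F \<theta> = fseries a \<theta>" by blast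
  show ?thesis
  proof (cases b)
    case False
    then show ?thesis using that a by blast
  next
    case True
    define a' where "a' = (\<lambda>k. 1 / 2 * (a k + conj_coeff a k))"
    have a'd: "fdecay \<rho> a'"
      unfolding a'_def by (intro fdecay_subexp fdecay_add fdecay_conj_coeff a subexp_bounded) simp
    moreover have "F \<theta> = fseries a' \<theta>" if \<theta>: "\<theta> \<in> strip \<rho>" for \<theta>
    proof -
      have "((\<lambda>k. 1 / 2 * (a k * cexp (kdot k \<theta>) + conj_coeff a k * cexp (kdot k \<theta>))) has_sum
          1 / 2 * (fseries a \<theta> + fseries (conj_coeff a) \<theta>)) UNIV"
        by (intro has_sum_cmult_right has_sum_add fdecay_summable(2)[OF _ \<theta>] fdecay_conj_coeff a)
      then have "((\<lambda>k. a' k * cexp (kdot k \<theta>)) has_sum 1 / 2 * (fseries a \<theta> + fseries (conj_coeff a) \<theta>)) UNIV"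
        by (simp add: a'_def algebra_simps)
      from has_sum_unique[OF fdecay_summable(2)[OF a'd \<theta>] this]
      have "fseries a' \<theta> = 1 / 2 * (fseries a \<theta> + fseries (conj_coeff a) \<theta>)" .
      moreover have "fseries (conj_coeff a) \<theta> = F \<theta>"
      proof -
        have "cnj (F \<theta>) = fseries a (vcnj \<theta>)"
          using a(2)[of "vcnj \<theta>"] \<theta> F True unfolding torus_analytic_def by auto
        then have "F \<theta> = cnj (fseries a (vcnj \<theta>))" by (metis complex_cnj_cnj)
        then show ?thesis using cnj_fseries[of a "vcnj \<theta>"] by simp
      qed
      ultimately show ?thesis using a(2)[OF \<theta>] by simp
    qed
    moreover have "conj_coeff a' = a'"
      by (auto simp: fun_eq_iff conj_coeff_def a'_def)
    ultimately show ?thesis using that by blast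
  qed
qed

text \<open>The linear equation solved at every order. Frequencies with nonzero \<psi> part are
  removed by \<open>V\<close>, and the others, on which the second difference vanishes, by
  \<open>lam\<close>.\<close>

lemma second_difference_solution:
  fixes R :: "complex^('n::finite option) \<Rightarrow> complex" and \<Omega> :: "real^'n"
  assumes \<rho>: "\<rho> > 0" and dioph: "subexponential_divisors \<Omega>"
    and nonres: "\<And>k :: int^'n. k \<noteq> 0 \<Longrightarrow> rvec k \<bullet> \<Omega> \<notin> \<int>"
    and R: "torus_analytic b \<rho> R"
  shows "\<exists>V lam. torus_analytic b \<rho> V \<and>
    (\<forall>\<eta> m. \<bar>Im \<eta>\<bar> < \<rho> \<longrightarrow> lam (\<eta> + of_int m) = lam \<eta>) \<and>
    (\<forall>\<psi> \<eta>. join \<psi> \<eta> \<in> strip \<rho> \<longrightarrow> V (join (\<psi> + cvec \<Omega>) \<eta>) + V (join (\<psi> - cvec \<Omega>) \<eta>)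
       - 2 * V (join \<psi> \<eta>) + R (join \<psi> \<eta>) + lam \<eta> = 0) \<and>
    (b \<longrightarrow> (\<forall>y. lam (complex_of_real y) \<in> \<real>))"
proof -
  obtain a where a: "fdecay \<rho> a" "\<And>\<theta>. \<theta> \<in> strip \<rho> \<Longrightarrow> R \<theta> = fseries a \<theta>" "b \<Longrightarrow> conj_coeff a = a"
    using torus_analytic_fourier[OF \<rho> R] by blast
  have a_conj: "cnj (a (- k)) = a k" if b for k
    using fun_cong[OF a(3)[OF that], of k] by (simp add: conj_coeff_def)
  define v where "v = (\<lambda>k. inv_divisor \<Omega> k * a k)"
  define l where "l = (\<lambda>k. (if some_part k = 0 then - 1 else 0) * a k)"
  have v: "fdecay \<rho> v" unfolding v_def by (intro fdecay_subexp a subexp_inv_divisor dioph)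
  have l: "fdecay \<rho> l" unfolding l_def by (intro fdecay_subexp a subexp_bounded) simp
  have sp: "some_part (- k) = - some_part k" for k :: "int^('n option)"
    by (simp add: some_part_def vec_eq_iff)
  have rv: "rvec (- k) = - rvec k" for k :: "int^'n"
    by (simp add: rvec_def vec_eq_iff)
  have "conj_coeff v = v" if b
    using a_conj[OF that] by (auto simp: fun_eq_iff conj_coeff_def v_def inv_divisor_def sp rv)
  then have V: "torus_analytic b \<rho> (fseries v)" using v by (intro torus_analytic_fseries)
  have "conj_coeff l = l" if b
    using a_conj[OF that] by (auto simp: fun_eq_iff conj_coeff_def l_def sp)
  then have L: "torus_analytic b \<rho> (fseries l)" using l by (intro torus_analytic_fseries)
  \<comment> \<open>The frequencies of \<open>l\<close> have zero \<psi> part, so the choice \<psi>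
    = 0 is arbitrary.\<close>
  define lam where "lam = (\<lambda>\<eta>. fseries l (join 0 \<eta>))"
  have lam_eq: "lam \<eta> = fseries l (join \<psi> \<eta>)" for \<psi> \<eta>
    unfolding lam_def fseries_def
    by (intro infsum_cong) (auto simp: l_def kdot_join)
  show ?thesis
  proof (intro exI[of _ "fseries v"] exI[of _ lam] conjI allI impI V)
    fix \<eta> :: complex and m :: int
    have eq: "join 0 (\<eta> + of_int m) = (join 0 \<eta> + cvec (rvec (axis None m)) :: complex^('n option))"
      by (auto simp: vec_eq_iff join_def cvec_def rvec_def axis_def split: option.splits)
    show "lam (\<eta> + of_int m) = lam \<eta>" unfolding lam_def eq by (rule fseries_periodic)
  next
    fix y :: real assume b
    have eq: "join 0 (complex_of_real y) = (cvec (axis None y) :: complex^('n option))"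
      by (auto simp: vec_eq_iff join_def cvec_def axis_def split: option.splits)
    have j: "vcnj (join 0 (of_real y)) = (join 0 (of_real y) :: complex^('n option))"
      "(join 0 (of_real y) :: complex^('n option)) \<in> strip \<rho>"
      unfolding eq vcnj_cvec using \<rho> by (simp_all add: strip_def cvec_def)
    have "lam (of_real y) = cnj (lam (of_real y))"
      using L \<open>b\<close> j unfolding torus_analytic_def lam_def by metis
    then show "lam (of_real y) \<in> \<real>" by (metis Reals_cnj_iff)
  next
    fix \<psi> :: "complex^'n" and \<eta> assume \<theta>: "join \<psi> \<eta> \<in> strip \<rho>"
    let ?O = "join (cvec \<Omega>) 0 :: complex^('n option)"
    have jp: "join (\<psi> + cvec \<Omega>) \<eta> = join \<psi> \<eta> + ?O" "join (\<psi> - cvec \<Omega>) \<eta> = join \<psi> \<eta> + (- ?O)"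
      by (auto simp: vec_eq_iff join_def split: option.splits)
    have O: "join (\<psi> + cvec \<Omega>) \<eta> \<in> strip \<rho>" "join (\<psi> - cvec \<Omega>) \<eta> \<in> strip \<rho>"
      using \<theta> by (auto simp: strip_def join_def cvec_def split: option.splits)
    let ?e = "\<lambda>k. cexp (kdot k (join \<psi> \<eta>))"
    have "((\<lambda>k. v k * cexp (kdot k (join (\<psi> + cvec \<Omega>) \<eta>)) + v k * cexp (kdot k (join (\<psi> - cvec \<Omega>) \<eta>))
          + (- 2) * (v k * ?e k) + a k * ?e k + l k * ?e k) has_sum
        fseries v (join (\<psi> + cvec \<Omega>) \<eta>) + fseries v (join (\<psi> - cvec \<Omega>) \<eta>)
          + (- 2) * fseries v (join \<psi> \<eta>) + fseries a (join \<psi> \<eta>) + fseries l (join \<psi> \<eta>)) UNIV"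
      by (intro has_sum_add has_sum_cmult_right fdecay_summable(2)[of \<rho>] v a l O \<theta>)
    moreover have "v k * cexp (kdot k (join (\<psi> + cvec \<Omega>) \<eta>)) + v k * cexp (kdot k (join (\<psi> - cvec \<Omega>) \<eta>))
          + (- 2) * (v k * ?e k) + a k * ?e k + l k * ?e k = 0" for k
    proof -
      let ?x = "rvec (some_part k) \<bullet> \<Omega>"
      have k0: "kdot k ?O = of_real ?x" by (simp add: kdot_join kdot_cvec)
      have "cexp (of_real ?x) + cexp (- of_real ?x) = of_real (2 * cos (2 * pi * ?x))"
        by (simp add: cexp_def complex_eq_iff Re_exp Im_exp)
      then have *: "cexp (kdot k ?O) + cexp (kdot k (- ?O)) - 2 = - of_real (2 - 2 * cos (2 * pi * ?x))"
        by (simp add: k0 kdot_minus)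
      have "v k * cexp (kdot k (join (\<psi> + cvec \<Omega>) \<eta>)) + v k * cexp (kdot k (join (\<psi> - cvec \<Omega>) \<eta>))
          + (- 2) * (v k * ?e k) = v k * ?e k * (cexp (kdot k ?O) + cexp (kdot k (- ?O)) - 2)"
        by (simp only: jp kdot_add[of k "join \<psi> \<eta>"] cexp_add) (simp add: algebra_simps)
      also have "\<dots> = - (v k * of_real (2 - 2 * cos (2 * pi * ?x))) * ?e k"
        unfolding * by (simp only: mult_minus_left mult_minus_right mult_ac)
      also have "v k * of_real (2 - 2 * cos (2 * pi * ?x)) = (if some_part k = 0 then 0 else a k)"
      proof (cases "some_part k = 0")
        case False
        \<comment> \<open>The integers are closed, so a non-integer has positive distance to them
          and the divisor is nonzero.\<close>
        have "0 < (infdist ?x \<int>)\<^sup>2"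
          using nonres[OF False] in_closure_iff_infdist_zero[of \<int> ?x] closed_Ints[where 'a = real]
          by (auto simp: zero_less_power2)
        also have "\<dots> \<le> 2 - 2 * cos (2 * pi * ?x)" by (rule cos_infdist_bound)
        finally have "2 - 2 * cos (2 * pi * ?x) \<noteq> 0" by simp
        then have "complex_of_real (2 - 2 * cos (2 * pi * ?x)) \<noteq> 0"
          using of_real_eq_0_iff by blast
        then show ?thesis using False
          by (simp add: v_def inv_divisor_def del: of_real_diff of_real_mult)
      qed (simp add: v_def inv_divisor_def)
      finally show ?thesis by (simp add: l_def)
    qed
    ultimately have "((\<lambda>k. 0) has_sum
        fseries v (join (\<psi> + cvec \<Omega>) \<eta>) + fseries v (join (\<psi> - cvec \<Omega>) \<eta>)
          + (- 2) * fseries v (join \<psi> \<eta>) + fseries a (join \<psi> \<eta>) + fseries l (join \<psi> \<eta>)) (UNIV :: (int^('n option)) set)"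
      by simp
    from has_sum_unique[OF this has_sum_0_simp]
    show "fseries v (join (\<psi> + cvec \<Omega>) \<eta>) + fseries v (join (\<psi> - cvec \<Omega>) \<eta>) - 2 * fseries v (join \<psi> \<eta>)
        + R (join \<psi> \<eta>) + lam \<eta> = 0"
      using a(2)[OF \<theta>] lam_eq[of \<eta> \<psi>] by (simp add: algebra_simps)
  qed
qed

section \<open>The algebra of analytic functions on the torus\<close>

lemma torus_analytic_cong:
  fixes F :: "complex^'m \<Rightarrow> complex"
  assumes F: "torus_analytic b \<rho> F" and eq: "\<And>\<theta>. \<theta> \<in> strip \<rho> \<Longrightarrow> G \<theta> = F \<theta>"
  shows "torus_analytic b \<rho> G"
proof -
  have "mv_analytic_on G (strip \<rho>)"
  proof (rule mv_analyticI[OF open_strip])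
    fix z :: "complex^'m" assume z: "z \<in> strip \<rho>"
    obtain D where D: "(F has_derivative D) (at z)" "\<And>c x. D (c *s x) = c * D x"
      using mv_analyticD[OF _ z] F unfolding torus_analytic_def by blast
    have "(G has_derivative D) (at z)"
      by (rule has_derivative_transform_within_open[OF D(1) open_strip z]) (simp add: eq)
    then show "\<exists>D. (G has_derivative D) (at z) \<and> (\<forall>c x. D (c *s x) = c * D x)" using D(2) by blast
  qed
  moreover have "periodic_on (strip \<rho>) G"
    using F eq unfolding torus_analytic_def periodic_on_def by simp
  ultimately show ?thesis using F eq unfolding torus_analytic_def by simp
qed

lemma torus_analytic_const:
  fixes c :: complex
  assumes "c \<in> \<real>"
  shows "torus_analytic b \<rho> (\<lambda>_. c)"
proof -
  have "mv_analytic_on (\<lambda>_. c) (strip \<rho>)"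
    by (rule mv_analyticI[OF open_strip]) (rule exI[of _ "\<lambda>_. 0"], simp)
  then show ?thesis using assms by (auto simp: torus_analytic_def periodic_on_def Reals_cnj_iff)
qed

lemma torus_analytic_add:
  fixes F G :: "complex^'m \<Rightarrow> complex"
  assumes F: "torus_analytic b \<rho> F" and G: "torus_analytic b \<rho> G"
  shows "torus_analytic b \<rho> (\<lambda>\<theta>. F \<theta> + G \<theta>)"
proof -
  have "mv_analytic_on (\<lambda>\<theta>. F \<theta> + G \<theta>) (strip \<rho>)"
  proof (rule mv_analyticI[OF open_strip])
    fix z :: "complex^'m" assume z: "z \<in> strip \<rho>"
    obtain D where D: "(F has_derivative D) (at z)" "\<And>c x. D (c *s x) = c * D x"
      using mv_analyticD[OF _ z] F unfolding torus_analytic_def by blast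
    obtain E where E: "(G has_derivative E) (at z)" "\<And>c x. E (c *s x) = c * E x"
      using mv_analyticD[OF _ z] G unfolding torus_analytic_def by blast
    have "((\<lambda>\<theta>. F \<theta> + G \<theta>) has_derivative (\<lambda>h. D h + E h)) (at z)"
      by (rule has_derivative_add[OF D(1) E(1)])
    moreover have "D (c *s x) + E (c *s x) = c * (D x + E x)" for c x
      by (simp add: D(2) E(2) distrib_left)
    ultimately show "\<exists>D. ((\<lambda>\<theta>. F \<theta> + G \<theta>) has_derivative D) (at z) \<and> (\<forall>c x. D (c *s x) = c * D x)"
      by (intro exI[of _ "\<lambda>h. D h + E h"]) blast
  qed
  then show ?thesis using F G by (auto simp: torus_analytic_def periodic_on_def)
qed

lemma torus_analytic_mult:
  fixes F G :: "complex^'m \<Rightarrow> complex"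
  assumes F: "torus_analytic b \<rho> F" and G: "torus_analytic b \<rho> G"
  shows "torus_analytic b \<rho> (\<lambda>\<theta>. F \<theta> * G \<theta>)"
proof -
  have "mv_analytic_on (\<lambda>\<theta>. F \<theta> * G \<theta>) (strip \<rho>)"
  proof (rule mv_analyticI[OF open_strip])
    fix z :: "complex^'m" assume z: "z \<in> strip \<rho>"
    obtain D where D: "(F has_derivative D) (at z)" "\<And>c x. D (c *s x) = c * D x"
      using mv_analyticD[OF _ z] F unfolding torus_analytic_def by blast
    obtain E where E: "(G has_derivative E) (at z)" "\<And>c x. E (c *s x) = c * E x"
      using mv_analyticD[OF _ z] G unfolding torus_analytic_def by blast
    have "((\<lambda>\<theta>. F \<theta> * G \<theta>) has_derivative (\<lambda>h. F z * E h + D h * G z)) (at z)"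
      by (rule has_derivative_mult[OF D(1) E(1)])
    moreover have "F z * E (c *s x) + D (c *s x) * G z = c * (F z * E x + D x * G z)" for c x
      by (simp add: D(2) E(2) algebra_simps)
    ultimately show "\<exists>D. ((\<lambda>\<theta>. F \<theta> * G \<theta>) has_derivative D) (at z) \<and> (\<forall>c x. D (c *s x) = c * D x)"
      by (intro exI[of _ "\<lambda>h. F z * E h + D h * G z"]) blast
  qed
  then show ?thesis using F G by (auto simp: torus_analytic_def periodic_on_def)
qed

lemma torus_analytic_sum:
  assumes "finite I" "\<And>i. i \<in> I \<Longrightarrow> torus_analytic b \<rho> (F i)"
  shows "torus_analytic b \<rho> (\<lambda>\<theta>. \<Sum>i\<in>I. F i \<theta>)"
  using assms by (induction I rule: finite_induct) (auto intro: torus_analytic_const torus_analytic_add)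

lemma torus_analytic_fps_power:
  assumes "\<And>n. torus_analytic b \<rho> (\<lambda>\<theta>. fps_nth (p \<theta>) n)"
  shows "torus_analytic b \<rho> (\<lambda>\<theta>. fps_nth (p \<theta> ^ i) n)"
proof (induction i arbitrary: n)
  case 0
  then show ?case by (cases n) (auto intro!: torus_analytic_const)
next
  case (Suc i)
  then show ?case
    unfolding power_Suc fps_mult_nth by (intro torus_analytic_sum torus_analytic_mult assms) auto
qed

text \<open>Carried out on the coefficients, where analyticity, periodicity and the symmetry of the
  derivative can be read off. The symmetry survives because the direction is real: conjugation
  changes the sign of i, reflection that of \<open>k\<close>.\<close>

lemma torus_analytic_directional_derivative:
  fixes F :: "complex^'m \<Rightarrow> complex"
  assumes \<rho>: "\<rho> > 0" and F: "torus_analytic b \<rho> F"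
  shows "\<exists>G. torus_analytic b \<rho> G \<and>
    (\<forall>\<theta> s. \<theta> + s *s cvec \<beta> \<in> strip \<rho> \<longrightarrow> ((\<lambda>s. F (\<theta> + s *s cvec \<beta>)) has_field_derivative G (\<theta> + s *s cvec \<beta>)) (at s))"
proof -
  obtain a where a: "fdecay \<rho> a" "\<And>\<theta>. \<theta> \<in> strip \<rho> \<Longrightarrow> F \<theta> = fseries a \<theta>" "b \<Longrightarrow> conj_coeff a = a"
    using torus_analytic_fourier[OF \<rho> F] by blast
  have "conj_coeff (dir_coeff a (cvec \<beta>)) = dir_coeff a (cvec \<beta>)" if b
  proof
    fix k
    have "cnj (a (- k)) = a k" using fun_cong[OF a(3)[OF that], of k] by (simp add: conj_coeff_def)
    then show "conj_coeff (dir_coeff a (cvec \<beta>)) k = dir_coeff a (cvec \<beta>) k"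
      by (simp add: conj_coeff_def dir_coeff_def cnj_kdot kdot_minus)
  qed
  then have "torus_analytic b \<rho> (fseries (dir_coeff a (cvec \<beta>)))"
    by (intro torus_analytic_fseries fdecay_dir_coeff a(1))
  moreover have "((\<lambda>s. F (\<theta> + s *s cvec \<beta>)) has_field_derivative fseries (dir_coeff a (cvec \<beta>)) (\<theta> + s *s cvec \<beta>)) (at s)"
    if \<theta>: "\<theta> + s *s cvec \<beta> \<in> strip \<rho>" for \<theta> s
  proof (rule line_derivative[where D = "\<lambda>h. fseries (dir_coeff a h) (\<theta> + s *s cvec \<beta>)"])
    show "(F has_derivative (\<lambda>h. fseries (dir_coeff a h) (\<theta> + s *s cvec \<beta>))) (at (\<theta> + s *s cvec \<beta>))"
      by (rule has_derivative_transform_within_open[OF fseries_derivative(1)[OF a(1) \<theta>] open_strip \<theta>])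
        (simp add: a(2))
  qed (rule fseries_derivative(2)[OF a(1) \<theta>])
  ultimately show ?thesis by blast
qed

lemma open_line_strip: "open {s. \<theta> + s *s b \<in> strip \<rho>}"
proof -
  have "continuous_on UNIV (\<lambda>s. \<theta> + s *s b)"
    by (intro continuous_intros bounded_linear.continuous_on[OF bounded_linear_scale])
  from open_vimage[OF open_strip this] show ?thesis by (simp add: vimage_def)
qed

text \<open>The identity is claimed along the whole part of the line inside the strip, not only at s
  = 0, because the induction step differentiates it and so needs it in a neighbourhood.\<close>

lemma torus_analytic_higher_derivative:
  fixes F :: "complex^'m \<Rightarrow> complex"
  assumes \<rho>: "\<rho> > 0" and F: "torus_analytic b \<rho> F"
  shows "\<exists>G. torus_analytic b \<rho> G \<and>
    (\<forall>\<theta> s. \<theta> + s *s cvec \<beta> \<in> strip \<rho> \<longrightarrow> (deriv ^^ i) (\<lambda>s. F (\<theta> + s *s cvec \<beta>)) s = G (\<theta> + s *s cvec \<beta>))"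
proof (induction i)
  case 0
  then show ?case using F by auto
next
  case (Suc i)
  then obtain G where G: "torus_analytic b \<rho> G"
    "\<And>\<theta> s. \<theta> + s *s cvec \<beta> \<in> strip \<rho> \<Longrightarrow> (deriv ^^ i) (\<lambda>s. F (\<theta> + s *s cvec \<beta>)) s = G (\<theta> + s *s cvec \<beta>)"
    by blast
  obtain H where H: "torus_analytic b \<rho> H"
    "\<And>\<theta> s. \<theta> + s *s cvec \<beta> \<in> strip \<rho> \<Longrightarrow>
       ((\<lambda>s. G (\<theta> + s *s cvec \<beta>)) has_field_derivative H (\<theta> + s *s cvec \<beta>)) (at s)"
    using torus_analytic_directional_derivative[OF \<rho> G(1)] by blast
  have "(deriv ^^ Suc i) (\<lambda>s. F (\<theta> + s *s cvec \<beta>)) s = H (\<theta> + s *s cvec \<beta>)"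
    if \<theta>: "\<theta> + s *s cvec \<beta> \<in> strip \<rho>" for \<theta> s
  proof -
    have "eventually (\<lambda>s. s \<in> {s. \<theta> + s *s cvec \<beta> \<in> strip \<rho>}) (nhds s)"
      by (rule eventually_nhds_in_open[OF open_line_strip]) (simp add: \<theta>)
    then have "eventually (\<lambda>s. (deriv ^^ i) (\<lambda>s. F (\<theta> + s *s cvec \<beta>)) s = G (\<theta> + s *s cvec \<beta>)) (nhds s)"
      by eventually_elim (simp add: G(2))
    then have "deriv ((deriv ^^ i) (\<lambda>s. F (\<theta> + s *s cvec \<beta>))) s = deriv (\<lambda>s. G (\<theta> + s *s cvec \<beta>)) s"
      by (rule deriv_cong_ev) simp
    also have "\<dots> = H (\<theta> + s *s cvec \<beta>)" by (rule DERIV_imp_deriv[OF H(2)[OF \<theta>]])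
    finally show ?thesis by simp
  qed
  then show ?case using H(1) by blast
qed

text \<open>Schwarz reflection on one complex line: with \<theta> = x + i y, the line s -> x + s y
  passes through \<theta> at s = i and through its conjugate at s = - i. The functions f s and cnj
  (f (cnj s)) agree for real s, hence on a band.\<close>

lemma real_imp_reflection_symmetric:
  fixes W :: "complex^'m \<Rightarrow> complex"
  assumes W: "mv_analytic_on W (strip \<rho>)" and real: "\<And>x. W (cvec x) \<in> \<real>" and \<theta>: "\<theta> \<in> strip \<rho>"
  shows "W (vcnj \<theta>) = cnj (W \<theta>)"
proof -
  obtain r0 where r0: "0 \<le> r0" "r0 < \<rho>" "\<theta> \<in> cstrip r0" using strip_imp_cstrip[OF \<theta>] by blast
  obtain r where r: "r0 < r" "r < \<rho>" using dense[OF r0(2)] by blast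
  define x y where "x = (\<chi> i. Re (\<theta> $ i))" and "y = (\<chi> i. Im (\<theta> $ i))"
  \<comment> \<open>A band of this height stays inside the strip since |y_i| < r. As 0 < r < \<rho>,
    it is well defined even for real \<theta>, and \<sigma> > 1 puts i and - i into the
    band.\<close>
  define \<sigma> where "\<sigma> = \<rho> / r"
  have "r > 0" using r r0 by simp
  then have \<sigma>: "\<sigma> > 1" using r by (simp add: \<sigma>_def)
  have in_strip: "cvec x + s *s cvec y \<in> strip \<rho>" if s: "s \<in> band \<sigma>" for s
    unfolding strip_def
  proof safe
    fix i
    have "\<bar>y $ i\<bar> \<le> r0" using r0 by (simp add: y_def cstrip_def)
    then have "\<bar>Im s\<bar> * \<bar>y $ i\<bar> \<le> \<bar>Im s\<bar> * r" using r by (intro mult_left_mono) auto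
    also have "\<dots> < \<sigma> * r" using s \<open>r > 0\<close> by (simp add: band_def)
    also have "\<dots> = \<rho>" using \<open>r > 0\<close> by (simp add: \<sigma>_def)
    finally show "\<bar>Im ((cvec x + s *s cvec y) $ i)\<bar> < \<rho>" by (simp add: cvec_def abs_mult)
  qed
  define f where "f = (\<lambda>s. W (cvec x + s *s cvec y))"
  have f: "f holomorphic_on band \<sigma>"
    unfolding f_def by (rule holomorphic_line[OF W in_strip])
  have cb: "cnj ` band \<sigma> = band \<sigma>"
    by (auto simp: band_def image_iff intro!: exI[of _ "cnj _"])
  have f': "(\<lambda>s. cnj (f (cnj s))) holomorphic_on band \<sigma>"
    using holomorphic_on_compose_cnj_cnj[of f "band \<sigma>"] f cb open_band by (simp add: o_def)
  have real_pt: "cvec x + of_real t *s cvec y = cvec (x + t *\<^sub>R y)" for t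
    by (simp add: vec_eq_iff cvec_def)
  have "f \<i> - cnj (f (cnj \<i>)) = 0"
  proof (rule analytic_continuation[where S = "band \<sigma>" and U = "\<real>" and \<xi> = 0
        and w = \<i> and f = "\<lambda>s. f s - cnj (f (cnj s))"])
    show "(\<lambda>s. f s - cnj (f (cnj s))) holomorphic_on band \<sigma>"
      by (intro holomorphic_intros f f')
    show "connected (band \<sigma>)" by (simp add: convex_connected convex_band)
    show "\<real> \<subseteq> band \<sigma>" using \<sigma> by (auto simp: band_def elim!: Reals_cases)
    show "(0::complex) islimpt \<real>"
      unfolding islimpt_approachable
    proof (intro allI impI)
      fix e :: real assume "e > 0"
      then show "\<exists>x'\<in>\<real>. x' \<noteq> 0 \<and> dist x' (0::complex) < e"
        by (intro bexI[of _ "of_real (e / 2)"]) auto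
    qed
    fix s :: complex assume "s \<in> \<real>"
    then obtain t where "s = of_real t" by (rule Reals_cases)
    moreover have "f (of_real t) \<in> \<real>" using real unfolding f_def real_pt by simp
    ultimately show "f s - cnj (f (cnj s)) = 0" by (simp add: Reals_cnj_iff)
  next
    show "0 \<in> band \<sigma>" "\<i> \<in> band \<sigma>" using \<sigma> by (simp_all add: band_def)
  qed (rule open_band)
  moreover have "cvec x + \<i> *s cvec y = \<theta>" "cvec x + (- \<i>) *s cvec y = vcnj \<theta>"
    by (simp_all add: vec_eq_iff complex_eq_iff cvec_def x_def y_def vcnj_def)
  ultimately show ?thesis by (simp add: f_def)
qed

text \<open>Allows a series to be replaced by its truncation when one coefficient of a composition
  is computed.\<close>

lemma fps_power_nth_cong:
  fixes a c :: "'a::comm_ring_1 fps"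
  assumes "\<And>j. j \<le> n \<Longrightarrow> fps_nth a j = fps_nth c j"
  shows "fps_nth (a ^ i) n = fps_nth (c ^ i) n"
  using assms
proof (induction i arbitrary: n)
  case (Suc i)
  have "fps_nth (a * a ^ i) n = fps_nth (c * c ^ i) n"
    unfolding fps_mult_nth by (intro sum.cong refl arg_cong2[of _ _ _ _ "(*)"] Suc) auto
  then show ?case by simp
qed simp

lemma fps_taylor_nth:
  assumes "fps_nth a 0 = 0"
  shows "fps_nth (fps_taylor W \<theta> b a) n =
    (\<Sum>i=0..n. (deriv ^^ i) (\<lambda>s. W (\<theta> + s *s b)) 0 / fact i * fps_nth (a ^ i) n)"
  by (simp add: fps_taylor_def assms fps_compose_nth fps_expansion_def)

theorem theorem1:
  fixes \<alpha> \<beta> :: "real^('n::finite option)"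
    and \<omega> \<rho> :: real
    and B :: "int^('n option)^('n option)"
    and \<Omega> :: "real^'n"
    and L :: "int^('n option)"
    and W :: "complex^('n option) \<Rightarrow> complex"
  assumes alpha: "\<And>k :: int^('n option). k \<noteq> 0 \<Longrightarrow> rvec k \<bullet> \<alpha> \<noteq> 0"
    and resonant: "\<exists>(k :: int^('n option)) (m :: int). k \<noteq> 0 \<and> rvec k \<bullet> (\<omega> *\<^sub>R \<alpha>) = real_of_int m"
    and B: "det B = 1"
    and Omega: "map_matrix real_of_int B *v (\<omega> *\<^sub>R \<alpha>) = join \<Omega> 0 + rvec L"
    and Omega_nonres: "\<And>k :: int^'n. k \<noteq> 0 \<Longrightarrow> rvec k \<bullet> \<Omega> \<notin> \<int>"
    and beta: "\<beta> = map_matrix real_of_int B *v \<alpha>"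
    and Omega_dioph: "subexponential_divisors \<Omega>"
    and rho: "\<rho> > 0"
    and W_per: "periodic_on (strip \<rho>) W"
    and W_an: "mv_analytic_on W (strip \<rho>)"
  shows "\<exists>(v :: complex^('n option) \<Rightarrow> complex fps) (lam :: complex \<Rightarrow> complex fps).
      periodic_on (strip \<rho>) v \<and>
      (\<forall>\<eta> m. \<bar>Im \<eta>\<bar> < \<rho> \<longrightarrow> lam (\<eta> + of_int m) = lam \<eta>) \<and>
      (\<forall>\<psi> \<eta>. join \<psi> \<eta> \<in> strip \<rho> \<longrightarrow>
         join \<psi> \<eta> + fps_nth (v (join \<psi> \<eta>)) 0 *s cvec \<beta> \<in> strip \<rho> \<and>
         v (join (\<psi> + cvec \<Omega>) \<eta>) + v (join (\<psi> - cvec \<Omega>) \<eta>) - 2 * v (join \<psi> \<eta>)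
           + fps_X * fps_taylor W (join \<psi> \<eta>) (cvec \<beta>) (v (join \<psi> \<eta>)) + lam \<eta> = 0) \<and>
      (\<forall>\<delta> n. 0 < \<delta> \<and> \<delta> < \<rho> \<longrightarrow> mv_analytic_on (\<lambda>\<theta>. fps_nth (v \<theta>) n) (strip (\<rho> - \<delta>))) \<and>
      ((\<forall>x. W (cvec x) \<in> \<real>) \<longrightarrow>
         (\<forall>n x. fps_nth (v (cvec x)) n \<in> \<real>) \<and>
         (\<forall>n (y :: real). fps_nth (lam (complex_of_real y)) n \<in> \<real>))"
proof -
  \<comment> \<open>The flag is fixed at the outset because \<open>v\<close> and \<open>lam\<close>
    must be chosen before the reality of \<open>W\<close> is assumed in the last clause.\<close>
  define b where "b \<longleftrightarrow> (\<forall>x. W (cvec x) \<in> \<real>)"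
  have W: "torus_analytic b \<rho> W"
    using W_per W_an real_imp_reflection_symmetric[OF W_an] unfolding torus_analytic_def b_def by blast
  define Q where "Q R V l \<longleftrightarrow> torus_analytic b \<rho> V \<and>
    (\<forall>\<eta> m. \<bar>Im \<eta>\<bar> < \<rho> \<longrightarrow> l (\<eta> + of_int m) = l \<eta>) \<and>
    (\<forall>\<psi> \<eta>. join \<psi> \<eta> \<in> strip \<rho> \<longrightarrow> V (join (\<psi> + cvec \<Omega>) \<eta>) + V (join (\<psi> - cvec \<Omega>) \<eta>)
       - 2 * V (join \<psi> \<eta>) + R (join \<psi> \<eta>) + l \<eta> = 0) \<and>
    (b \<longrightarrow> (\<forall>y. l (complex_of_real y) \<in> \<real>))"
    for R V :: "complex^('n option) \<Rightarrow> complex" and l :: "complex \<Rightarrow> complex"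
  \<comment> \<open>\<open>V\<close> is chosen among those that admit some \<open>l\<close>, and
    then \<open>l\<close> for this \<open>V\<close>, so that the two choices fit together.\<close>
  define sv where "sv R = (SOME V. \<exists>l. Q R V l)" for R
  define sl where "sl R = (SOME l. Q R (sv R) l)" for R
  have Q: "Q R (sv R) (sl R)" if "torus_analytic b \<rho> R" for R
  proof -
    have "\<exists>V l. Q R V l"
      unfolding Q_def by (rule second_difference_solution[OF rho Omega_dioph Omega_nonres that])
    then have "\<exists>l. Q R (sv R) l" unfolding sv_def by (rule someI_ex)
    then show ?thesis unfolding sl_def by (rule someI_ex)
  qed
  define T where "T p n \<theta> = fps_nth (fps_taylor W \<theta> (cvec \<beta>) (p \<theta>)) n"
    for p :: "complex^('n option) \<Rightarrow> complex fps" and n \<theta>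
  \<comment> \<open>The recursion runs on partial sums, so that all earlier orders are available
    from the previous value alone. The factor \<epsilon> in front of \<open>W\<close> shifts the
    index: coefficient n of \<open>W\<close> along \<open>P n\<close> is the right-hand side at
    order n + 1.\<close>
  define P where "P = rec_nat (\<lambda>_. 0) (\<lambda>n p \<theta>. p \<theta> + fps_const (sv (T p n) \<theta>) * fps_X ^ Suc n)"
  have P0: "P 0 = (\<lambda>_. 0)" by (simp add: P_def)
  have PSuc: "P (Suc n) \<theta> = P n \<theta> + fps_const (sv (T (P n) n) \<theta>) * fps_X ^ Suc n" for n \<theta>
    by (simp add: P_def)
  have P_nth_Suc: "fps_nth (P (Suc n) \<theta>) j = fps_nth (P n \<theta>) j + (if j = Suc n then sv (T (P n) n) \<theta> else 0)" for n \<theta> j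
    unfolding PSuc by (simp add: fps_X_power_nth del: power_Suc)
  have P_high: "fps_nth (P n \<theta>) j = 0" if "n < j" for n \<theta> j
    using that by (induction n arbitrary: j) (auto simp: P0 P_nth_Suc)
  have P_zero: "fps_nth (P n \<theta>) 0 = 0" for n \<theta>
    by (induction n) (auto simp: P0 P_nth_Suc)
  have T_an: "torus_analytic b \<rho> (T p n)"
    if p: "\<And>j. torus_analytic b \<rho> (\<lambda>\<theta>. fps_nth (p \<theta>) j)" "\<And>\<theta>. fps_nth (p \<theta>) 0 = 0" for p n
  proof -
    have "\<exists>G. torus_analytic b \<rho> G \<and> (\<forall>\<theta>\<in>strip \<rho>. (deriv ^^ i) (\<lambda>s. W (\<theta> + s *s cvec \<beta>)) 0 = G \<theta>)" for i
    proof -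
      obtain G where "torus_analytic b \<rho> G" and G: "\<And>\<theta> s. \<theta> + s *s cvec \<beta> \<in> strip \<rho> \<Longrightarrow>
          (deriv ^^ i) (\<lambda>s. W (\<theta> + s *s cvec \<beta>)) s = G (\<theta> + s *s cvec \<beta>)"
        using torus_analytic_higher_derivative[OF rho W] by blast
      then show ?thesis using G[where s = 0] by (intro exI[of _ G]) simp
    qed
    then obtain G where G: "\<And>i. torus_analytic b \<rho> (G i)"
      "\<And>i \<theta>. \<theta> \<in> strip \<rho> \<Longrightarrow> (deriv ^^ i) (\<lambda>s. W (\<theta> + s *s cvec \<beta>)) 0 = G i \<theta>"
      by metis
    \<comment> \<open>Real constants keep the reflection symmetry of the Taylor
      coefficients.\<close>
    have "(1 / fact i :: complex) \<in> \<real>" for i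
      by (metis Reals_1 Reals_divide Reals_of_real of_real_fact)
    then have "torus_analytic b \<rho> (\<lambda>\<theta>. \<Sum>i=0..n. G i \<theta> * (1 / fact i) * fps_nth (p \<theta> ^ i) n)"
      by (intro torus_analytic_sum torus_analytic_mult torus_analytic_fps_power G torus_analytic_const p) auto
    then show ?thesis
      by (rule torus_analytic_cong) (simp add: T_def fps_taylor_nth p(2) G(2))
  qed
  have P_an: "torus_analytic b \<rho> (\<lambda>\<theta>. fps_nth (P n \<theta>) j)" for n j
  proof (induction n arbitrary: j)
    case 0
    then show ?case by (simp add: P0 torus_analytic_const)
  next
    case (Suc n)
    have "torus_analytic b \<rho> (sv (T (P n) n))"
      using Q[OF T_an[OF Suc P_zero]] unfolding Q_def by blast
    then show ?case
      unfolding P_nth_Suc by (cases "j = Suc n") (simp_all add: Suc torus_analytic_add)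
  qed
  have QT: "Q (T (P n) n) (sv (T (P n) n)) (sl (T (P n) n))" for n
    by (rule Q[OF T_an[OF P_an P_zero]])
  \<comment> \<open>The diagonal: coefficient n no longer changes after stage n.\<close>
  define v where "v \<theta> = Abs_fps (\<lambda>n. fps_nth (P n \<theta>) n)" for \<theta>
  \<comment> \<open>Order 0 of the equation holds with both terms 0, since \<epsilon> W starts at
    order 1.\<close>
  define lam where "lam \<eta> = Abs_fps (\<lambda>n. case n of 0 \<Rightarrow> 0 | Suc m \<Rightarrow> sl (T (P m) m) \<eta>)" for \<eta>
  have v0: "fps_nth (v \<theta>) 0 = 0" for \<theta> by (simp add: v_def P0)
  have vSuc: "fps_nth (v \<theta>) (Suc n) = sv (T (P n) n) \<theta>" for n \<theta>
    by (simp add: v_def P_nth_Suc P_high)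
  have v_P: "fps_nth (v \<theta>) j = fps_nth (P n \<theta>) j" if "j \<le> n" for j n \<theta>
    using that
  proof (induction n)
    case (Suc n)
    show ?case
    proof (cases "j = Suc n")
      case False
      then show ?thesis using Suc by (simp add: P_nth_Suc)
    qed (simp add: v_def)
  qed (simp add: v_def)
  have v_an: "torus_analytic b \<rho> (\<lambda>\<theta>. fps_nth (v \<theta>) n)" for n
    using P_an[of n n] by (simp add: v_def)
  \<comment> \<open>Because the constant terms vanish, coefficient n of the Taylor series involves
    only the coefficients up to n, where \<open>v\<close> and \<open>P n\<close> agree.\<close>
  have T_v: "fps_nth (fps_taylor W \<theta> (cvec \<beta>) (v \<theta>)) n = T (P n) n \<theta>" for n \<theta>
    unfolding T_def fps_taylor_nth[OF v0] fps_taylor_nth[OF P_zero]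
    by (intro sum.cong refl arg_cong2[of _ _ _ _ "(*)"] fps_power_nth_cong v_P)
  show ?thesis
  proof (intro exI[of _ v] exI[of _ lam] conjI allI impI)
    show "periodic_on (strip \<rho>) v"
      using v_an unfolding torus_analytic_def periodic_on_def fps_eq_iff by blast
  next
    fix \<eta> :: complex and m :: int assume "\<bar>Im \<eta>\<bar> < \<rho>"
    then show "lam (\<eta> + of_int m) = lam \<eta>"
      using QT unfolding Q_def lam_def by (auto simp: fps_eq_iff split: nat.splits)
  next
    fix \<psi> :: "complex^'n" and \<eta> assume \<theta>: "join \<psi> \<eta> \<in> strip \<rho>"
    then show "join \<psi> \<eta> + fps_nth (v (join \<psi> \<eta>)) 0 *s cvec \<beta> \<in> strip \<rho>"
      by (simp add: v0)
    show "v (join (\<psi> + cvec \<Omega>) \<eta>) + v (join (\<psi> - cvec \<Omega>) \<eta>) - 2 * v (join \<psi> \<eta>)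
           + fps_X * fps_taylor W (join \<psi> \<eta>) (cvec \<beta>) (v (join \<psi> \<eta>)) + lam \<eta> = 0"
    proof (rule fps_ext)
      fix n
      have two: "fps_nth (2 * x) n = 2 * fps_nth x n" for x :: "complex fps"
        unfolding numeral_fps_const fps_mult_left_const_nth by simp
      show "fps_nth (v (join (\<psi> + cvec \<Omega>) \<eta>) + v (join (\<psi> - cvec \<Omega>) \<eta>) - 2 * v (join \<psi> \<eta>)
           + fps_X * fps_taylor W (join \<psi> \<eta>) (cvec \<beta>) (v (join \<psi> \<eta>)) + lam \<eta>) n = fps_nth 0 n"
      proof (cases n)
        case 0
        then show ?thesis by (simp add: v0 lam_def)
      next
        case (Suc m)
        have lamSuc: "fps_nth (lam \<eta>) (Suc m) = sl (T (P m) m) \<eta>" by (simp add: lam_def)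
        show ?thesis
          unfolding fps_add_nth fps_sub_nth two fps_X_mult_nth
          unfolding Suc vSuc lamSuc
          using QT[of m, unfolded Q_def] \<theta> T_v by simp
      qed
    qed
  next
    fix \<delta> n assume "0 < \<delta> \<and> \<delta> < \<rho>"
    then have "strip (\<rho> - \<delta>) \<subseteq> (strip \<rho> :: (complex^('n option)) set)"
      by (auto simp: strip_def intro: less_trans)
    then show "mv_analytic_on (\<lambda>\<theta>. fps_nth (v \<theta>) n) (strip (\<rho> - \<delta>))"
      using v_an mv_analytic_on_subset unfolding torus_analytic_def by blast
  next
    fix n and x :: "real^('n option)" assume "\<forall>x. W (cvec x) \<in> \<real>"
    then have b by (simp add: b_def)
    moreover have "cvec x \<in> strip \<rho>" using rho by (simp add: strip_def cvec_def)
    ultimately have "fps_nth (v (vcnj (cvec x))) n = cnj (fps_nth (v (cvec x)) n)"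
      using v_an[of n] unfolding torus_analytic_def by blast
    then show "fps_nth (v (cvec x)) n \<in> \<real>" by (simp add: Reals_cnj_iff)
  next
    fix n and y :: real assume "\<forall>x. W (cvec x) \<in> \<real>"
    then have b by (simp add: b_def)
    then show "fps_nth (lam (complex_of_real y)) n \<in> \<real>"
      using QT unfolding Q_def lam_def by (auto split: nat.splits)
  qed
qed

end
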